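(* Let $n \geq 2$ and let $A(2n) = \langle x, y \;\|\; (xy)^n = (yx)^n \rangle$ be the 2-generated Artin group. Let $\lambda, \mu \in \mathbb{C}$ and $s \in \mathbb{C}^*$. Then the map $$\rho : A(2n) \to \mathrm{GL}_{2n}(\mathbb{Z}[\lambda, \mu, s^{\pm 1}])$$ defined on the generators by $$ x^{\rho} = \mathrm{diag} \left( \left( \begin{array}{cc} 1 & 0 \\ \lambda & 1 \end{array} \right), \ldots , \left( \begin{array}{cc} 1 & 0 \\ \lambda & 1 \end{array} \right) \right), \qquad y^{\rho} = \left( \begin{array}{ccccc} \mathbf{0} & A & \mathbf{0} & \cdots & \mathbf{0} \\ \mathbf{0} & \mathbf{0} & A & \cdots & \mathbf{0} \\ \vdots & & & \ddots & \vdots \\ \mathbf{0} & \mathbf{0} & \mathbf{0} & \cdots & A \\ B & \mathbf{0} & \mathbf{0} & \cdots & \mathbf{0} \end{array} \right), $$ where $$ A = \left( \begin{array}{cc} 1 & -\mu \\ 0 & 1 \end{array} \right), \qquad B = s \left( \begin{array}{cc} 1 & 0 \\ -\lambda & 1 \end{array} \right) \left( \begin{array}{cc} 1 - \lambda \mu & \mu \\ - \lambda & 1 \end{array} \right)^{n-1}, $$ is a linear representation of $A(2n)$. In addition, if $|\lambda| \geq 2$, $|\mu| \geq 2$ and $s$ is not a root of unity, then this representation is faithful.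
   Context: The matrices $x^\rho, y^\rho$ are $2n\times 2n$, written as $n \times n$ block matrices with $2\times 2$ blocks; $\mathbf{0}$ is the zero $2\times 2$ block. In $y^\rho$ the only nonzero blocks are $A$ at positions $(i,i+1)$, $i=1,\dots,n-1$, and $B$ at position $(n,1)$. $\mathbb{Z}[\lambda,\mu,s^{\pm1}]$ is the subring of $\mathbb{C}$ generated by $\lambda,\mu,s,s^{-1}$. *)

theory Defs
  imports
    "HOL-Algebra.Generated_Rings"
    "Jordan_Normal_Form.VS_Connect"
begin

text \<open>
  A letter \<open>(a, True)\<close> stands for the generator \<open>a\<close> and \<open>(a, False)\<close> for its formal inverse.
\<close>

type_synonym 'a word = "('a \<times> bool) list"

text \<open>
  The congruence on words generated by free cancellation and by the relations
  \<open>u = v\<close> with \<open>(u, v) \<in> R\<close>.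
\<close>

inductive pres_eq :: "('a word \<times> 'a word) set \<Rightarrow> 'a word \<Rightarrow> 'a word \<Rightarrow> bool"
  for R where
  refl: "pres_eq R u u"
| sym: "pres_eq R u v \<Longrightarrow> pres_eq R v u"
| trans: "pres_eq R u v \<Longrightarrow> pres_eq R v w \<Longrightarrow> pres_eq R u w"
| append: "pres_eq R u u' \<Longrightarrow> pres_eq R v v' \<Longrightarrow> pres_eq R (u @ v) (u' @ v')"
| cancel: "pres_eq R [(a, e), (a, \<not> e)] []"
| relation: "(u, v) \<in> R \<Longrightarrow> pres_eq R u v"

definition pres_class :: "('a word \<times> 'a word) set \<Rightarrow> 'a word \<Rightarrow> 'a word set" where
  "pres_class R w = {v. pres_eq R w v}"

text \<open>The generators are all elements of the type \<open>'a\<close>.\<close>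

definition presented_group :: "('a word \<times> 'a word) set \<Rightarrow> 'a word set monoid" where
  "presented_group R =
    \<lparr>carrier = range (pres_class R),
     monoid.mult = (\<lambda>C D. \<Union>u\<in>C. \<Union>v\<in>D. pres_class R (u @ v)),
     monoid.one = pres_class R []\<rparr>"

lemma pres_class_eq_iff: "pres_class R u = pres_class R v \<longleftrightarrow> pres_eq R u v"
  unfolding pres_class_def
  by (auto intro: pres_eq.refl pres_eq.sym pres_eq.trans)

lemma presented_group_mult:
  "pres_class R u \<otimes>\<^bsub>presented_group R\<^esub> pres_class R v = pres_class R (u @ v)"
proof -
  have "pres_class R (u' @ v') = pres_class R (u @ v)"
    if "u' \<in> pres_class R u" "v' \<in> pres_class R v" for u' v'
    using that by (simp add: pres_class_eq_iff) (simp add: pres_class_def pres_eq.append pres_eq.sym)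
  moreover have "u \<in> pres_class R u" "v \<in> pres_class R v"
    by (simp_all add: pres_class_def pres_eq.refl)
  ultimately show ?thesis
    unfolding presented_group_def monoid.simps by blast
qed

lemma pres_eq_inverse:
  "pres_eq R (map (\<lambda>(a, e). (a, \<not> e)) (rev w) @ w) []"
proof (induction w)
  case Nil
  show ?case by (simp add: pres_eq.refl)
next
  case (Cons l w)
  obtain a e where l: "l = (a, e)" by force
  let ?i = "map (\<lambda>(a, e). (a, \<not> e)) (rev w)"
  have "pres_eq R (?i @ ([(a, \<not> e), (a, \<not> \<not> e)] @ w)) (?i @ ([] @ w))"
    by (intro pres_eq.append pres_eq.refl pres_eq.cancel)
  then have "pres_eq R (?i @ ([(a, \<not> e), (a, e)] @ w)) (?i @ w)"
    by simp
  from pres_eq.trans[OF this Cons.IH] show ?case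
    by (simp add: l)
qed

lemma group_presented_group: "group (presented_group R)"
proof -
  let ?G = "presented_group R"
  have carr: "carrier ?G = range (pres_class R)" and one: "\<one>\<^bsub>?G\<^esub> = pres_class R []"
    by (simp_all add: presented_group_def)
  have "\<exists>D\<in>carrier ?G. D \<otimes>\<^bsub>?G\<^esub> pres_class R w = \<one>\<^bsub>?G\<^esub>" for w
  proof
    show "pres_class R (map (\<lambda>(a, e). (a, \<not> e)) (rev w)) \<otimes>\<^bsub>?G\<^esub> pres_class R w = \<one>\<^bsub>?G\<^esub>"
      by (simp add: presented_group_mult one pres_class_eq_iff pres_eq_inverse)
  qed (simp add: carr)
  then show ?thesis
    by (intro groupI) (auto simp: carr one presented_group_mult)
qed

datatype artin_gen = Gen_x | Gen_y

definition artin_relations :: "nat \<Rightarrow> (artin_gen word \<times> artin_gen word) set" where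
  "artin_relations n =
    {(concat (replicate n [(Gen_x, True), (Gen_y, True)]),
      concat (replicate n [(Gen_y, True), (Gen_x, True)]))}"

text \<open>The argument is half the label, so this is \<open>A(2 n)\<close>.\<close>

definition artin_group :: "nat \<Rightarrow> artin_gen word set monoid" where
  "artin_group n = presented_group (artin_relations n)"

definition artin_x :: "nat \<Rightarrow> artin_gen word set" where
  "artin_x n = pres_class (artin_relations n) [(Gen_x, True)]"

definition artin_y :: "nat \<Rightarrow> artin_gen word set" where
  "artin_y n = pres_class (artin_relations n) [(Gen_y, True)]"

definition laurent_ring :: "complex \<Rightarrow> complex \<Rightarrow> complex \<Rightarrow> complex set" where
  "laurent_ring lam mu s = generate_ring class_ring {lam, mu, s, inverse s}"

text \<open>The inverse matrix, too, has to have its entries in \<open>K\<close>.\<close>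

definition GL :: "nat \<Rightarrow> complex set \<Rightarrow> complex mat monoid" where
  "GL m K = units_of ((ring_mat TYPE(complex) m ())
     \<lparr>carrier := {M \<in> carrier_mat m m. elements_mat M \<subseteq> K}\<rparr>)"

definition mat2 :: "'a \<Rightarrow> 'a \<Rightarrow> 'a \<Rightarrow> 'a \<Rightarrow> 'a mat" where
  "mat2 a b c d = mat_of_rows_list 2 [[a, b], [c, d]]"

text \<open>The block in block row \<open>i\<close> and block column \<open>j\<close> (both counted from 0) is \<open>F i j\<close>.\<close>

definition block_mat2 :: "nat \<Rightarrow> (nat \<Rightarrow> nat \<Rightarrow> 'a mat) \<Rightarrow> 'a mat" where
  "block_mat2 n F =
    mat (2 * n) (2 * n) (\<lambda>(i, j). F (i div 2) (j div 2) $$ (i mod 2, j mod 2))"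

definition block_A :: "complex \<Rightarrow> complex mat" where
  "block_A mu = mat2 1 (- mu) 0 1"

definition block_B :: "nat \<Rightarrow> complex \<Rightarrow> complex \<Rightarrow> complex \<Rightarrow> complex mat" where
  "block_B n lam mu s =
    s \<cdot>\<^sub>m (mat2 1 0 (- lam) 1 * mat2 (1 - lam * mu) mu (- lam) 1 ^\<^sub>m (n - 1))"

definition x_mat :: "nat \<Rightarrow> complex \<Rightarrow> complex mat" where
  "x_mat n lam = diag_block_mat (replicate n (mat2 1 0 lam 1))"

definition y_mat :: "nat \<Rightarrow> complex \<Rightarrow> complex \<Rightarrow> complex \<Rightarrow> complex mat" where
  "y_mat n lam mu s = block_mat2 n (\<lambda>i j.
     if j = i + 1 then block_A mu
     else if i = n - 1 \<and> j = 0 then block_B n lam mu s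
     else 0\<^sub>m 2 2)"

end

theory Submission
  imports Defs
begin

text \<open>
  Put \<open>t = x y\<close> and let \<open>L\<close> be the diagonal block of the image of \<open>x\<close>, \<open>M = L A\<close>. Then
  \<open>L B = s M\<^sup>-\<^sup>(\<^sup>n\<^sup>-\<^sup>1\<^sup>)\<close>, so the image of \<open>t\<^sup>n\<close> is the scalar matrix \<open>s\<close>; this gives the relation, since
  \<open>(x y)\<^sup>n = (y x)\<^sup>n\<close> says that \<open>t\<^sup>n\<close> commutes with \<open>x\<close>.

  For faithfulness, all matrices involved are block monomial. Following the nonzero block of the
  first block row along a word \<open>u\<close> produces a word \<open>v\<close> such that \<open>u\<close> and \<open>v\<close> agree up to a power of
  the central element \<open>t\<^sup>n\<close>, and this block is, up to the same power of \<open>s\<close>, the value of \<open>v\<close> under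
  \<open>x \<mapsto> L\<close>, \<open>y \<mapsto> A\<close>. If \<open>u\<close> is in the kernel, comparing determinants shows that the power is
  trivial because \<open>s\<close> is not a root of unity. Then \<open>v\<close> is trivial, because \<open>L\<close> and \<open>A\<close> generate a
  free group by ping-pong on vectors \<open>(a, b)\<close> with \<open>\<bar>a\<bar> < \<bar>b\<bar>\<close> or \<open>\<bar>b\<bar> < \<bar>a\<bar>\<close>.
\<close>

subsection \<open>Words and presented groups\<close>

lemma pres_eq_mono:
  assumes "pres_eq R u v" and "R \<subseteq> S"
  shows "pres_eq S u v"
  using assms(1)
  by induction (use assms(2) in \<open>auto intro: pres_eq.intros\<close>)

text \<open>Freely reduced words: neighbours on the same generator must have the same sign, which
  excludes exactly the cancelling pairs.\<close>

definition reduced :: "'a word \<Rightarrow> bool" where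
  "reduced = successively (\<lambda>l m. fst l = fst m \<longrightarrow> snd l = snd m)"

lemma reduced_Cons:
  "reduced ((a, e) # w) \<longleftrightarrow> reduced w \<and> (\<forall>d w'. w = (a, d) # w' \<longrightarrow> d = e)"
  by (cases w) (auto simp: reduced_def)

text \<open>Letters are put in front one at a time. Since the tail is already reduced, a new letter
  can only cancel against its head, and what remains of the tail is still reduced.\<close>

lemma ex_reduced: "\<exists>v. reduced v \<and> pres_eq {} w v"
proof (induction w)
  case Nil
  show ?case by (intro exI[of _ "[]"]) (simp add: reduced_def pres_eq.refl)
next
  case (Cons l w)
  obtain a e where l: "l = (a, e)" by force
  from Cons.IH obtain v where v: "reduced v" "pres_eq {} w v" by blast
  have eq: "pres_eq {} (l # w) ((a, e) # v)"
    using pres_eq.append[OF pres_eq.refl[of "{}" "[l]"] v(2)] by (simp add: l)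
  show ?case
  proof (cases "reduced ((a, e) # v)")
    case False
    then obtain v' where v': "v = (a, \<not> e) # v'"
      using v(1) by (auto simp: reduced_Cons)
    have "pres_eq {} ([(a, e), (a, \<not> e)] @ v') ([] @ v')"
      by (intro pres_eq.append pres_eq.cancel pres_eq.refl)
    then have "pres_eq {} (l # w) v'"
      using pres_eq.trans[OF eq] by (simp add: v')
    moreover have "reduced v'"
      using v(1) by (simp add: v' reduced_Cons)
    ultimately show ?thesis by blast
  qed (use eq in blast)
qed

section \<open>Evaluation of words in a group\<close>

primrec word_eval :: "('b, 'c) monoid_scheme \<Rightarrow> ('a \<Rightarrow> 'b) \<Rightarrow> 'a word \<Rightarrow> 'b" where
  "word_eval H h [] = \<one>\<^bsub>H\<^esub>"
| "word_eval H h (l # w) =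
     (if snd l then h (fst l) else inv\<^bsub>H\<^esub> h (fst l)) \<otimes>\<^bsub>H\<^esub> word_eval H h w"

context group
begin

lemma word_eval_closed: "range h \<subseteq> carrier G \<Longrightarrow> word_eval G h w \<in> carrier G"
  by (induction w) auto

lemma word_eval_append:
  "range h \<subseteq> carrier G \<Longrightarrow> word_eval G h (u @ v) = word_eval G h u \<otimes> word_eval G h v"
  by (induction u) (auto simp: word_eval_closed m_assoc range_subsetD)

lemma word_eval_concat_replicate:
  "range h \<subseteq> carrier G \<Longrightarrow>
    word_eval G h (concat (replicate k w)) = word_eval G h w [^] k"
proof (induction k)
  case (Suc k)
  then show ?case
    using nat_pow_Suc2[OF word_eval_closed, of h w k] by (simp add: word_eval_append)
qed simp

lemma word_eval_pres_eq:
  assumes "pres_eq R u v" and h: "range h \<subseteq> carrier G"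
    and R: "\<And>u v. (u, v) \<in> R \<Longrightarrow> word_eval G h u = word_eval G h v"
  shows "word_eval G h u = word_eval G h v"
  using assms(1)
proof induction
  case (cancel a e)
  have "h a \<in> carrier G" using h by blast
  then show ?case by simp
qed (simp_all add: word_eval_append h R)

text \<open>Von Dyck's theorem: by \<open>word_eval_pres_eq\<close> evaluation is constant on each
  class, so it descends to the presented group.\<close>

lemma ex_hom_presented_group:
  assumes h: "range h \<subseteq> carrier G"
    and R: "\<And>u v. (u, v) \<in> R \<Longrightarrow> word_eval G h u = word_eval G h v"
  shows "\<exists>\<rho>\<in>hom (presented_group R) G. \<forall>w. \<rho> (pres_class R w) = word_eval G h w"
proof -
  \<comment> \<open>A class is evaluated through an arbitrary representative; the next fact shows
    that the choice does not matter.\<close>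
  define \<rho> where "\<rho> C = word_eval G h (SOME w. w \<in> C)" for C
  have \<rho>: "\<rho> (pres_class R w) = word_eval G h w" for w
  proof -
    have "w \<in> pres_class R w"
      by (simp add: pres_class_def pres_eq.refl)
    then have "(SOME v. v \<in> pres_class R w) \<in> pres_class R w"
      by (rule someI)
    then have "pres_eq R w (SOME v. v \<in> pres_class R w)"
      by (simp add: pres_class_def)
    from word_eval_pres_eq[OF this h R] show ?thesis
      by (simp add: \<rho>_def)
  qed
  moreover have "\<rho> \<in> hom (presented_group R) G"
  proof (rule homI)
    fix C D assume "C \<in> carrier (presented_group R)" "D \<in> carrier (presented_group R)"
    then obtain u v where "C = pres_class R u" "D = pres_class R v"
      by (auto simp: presented_group_def)
    then show "\<rho> (C \<otimes>\<^bsub>presented_group R\<^esub> D) = \<rho> C \<otimes> \<rho> D"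
      by (simp add: presented_group_mult \<rho> word_eval_append h)
  qed (auto simp: presented_group_def \<rho> word_eval_closed h)
  ultimately show ?thesis by blast
qed

text \<open>Both sides are the same alternating product, bracketed differently. This translates
  between the Artin relation and the fact that \<open>(x y)^n\<close> commutes with
  \<open>x\<close>, in both directions.\<close>

lemma pow_mult_swap:
  assumes "x \<in> carrier G" "y \<in> carrier G"
  shows "x \<otimes> (y \<otimes> x) [^] (k::nat) = (x \<otimes> y) [^] k \<otimes> x"
proof (induction k)
  case (Suc k)
  have "x \<otimes> (y \<otimes> x) [^] Suc k = (x \<otimes> (y \<otimes> x) [^] k) \<otimes> (y \<otimes> x)"
    using assms by (simp add: m_assoc)
  also have "\<dots> = (x \<otimes> y) [^] Suc k \<otimes> x"
    unfolding Suc using assms by (simp add: m_assoc)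
  finally show ?case .
qed (use assms in simp)

end

lemma pres_class_append:
  "pres_class R (u @ v) = pres_class R u \<otimes>\<^bsub>presented_group R\<^esub> pres_class R v"
  by (simp add: presented_group_mult)

lemma pres_class_in_carrier: "pres_class R w \<in> carrier (presented_group R)"
  by (simp add: presented_group_def)

lemma pres_class_Nil: "pres_class R [] = \<one>\<^bsub>presented_group R\<^esub>"
  by (simp add: presented_group_def)

lemma pres_class_inv_letter:
  "pres_class R [(a, False)] = inv\<^bsub>presented_group R\<^esub> pres_class R [(a, True)]"
proof -
  interpret group "presented_group R" by (rule group_presented_group)
  have "pres_eq R [(a, False), (a, True)] []"
    using pres_eq.cancel[of R a False] by simp
  then have "pres_class R [(a, False)] \<otimes>\<^bsub>presented_group R\<^esub> pres_class R [(a, True)] =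
      \<one>\<^bsub>presented_group R\<^esub>"
    by (simp add: presented_group_mult pres_class_eq_iff flip: pres_class_Nil)
  then show ?thesis
    using inv_equality pres_class_in_carrier by metis
qed

lemma pres_class_concat_replicate:
  "pres_class R (concat (replicate k w)) = pres_class R w [^]\<^bsub>presented_group R\<^esub> k"
proof -
  interpret group "presented_group R" by (rule group_presented_group)
  show ?thesis
  proof (induction k)
    case (Suc k)
    then show ?case
      using nat_pow_Suc2[OF pres_class_in_carrier, of w k] by (simp add: pres_class_append)
  qed (simp add: pres_class_Nil)
qed

subsection \<open>Two by two matrices\<close>

lemma mat2_carrier [simp]: "mat2 a b c d \<in> carrier_mat 2 2"
  unfolding mat2_def mat_of_rows_list_def by (rule carrier_matI) simp_all

lemma mat2_index [simp]:
  "mat2 a b c d $$ (0, 0) = a" "mat2 a b c d $$ (0, Suc 0) = b"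
  "mat2 a b c d $$ (Suc 0, 0) = c" "mat2 a b c d $$ (Suc 0, Suc 0) = d"
  by (simp_all add: mat2_def mat_of_rows_list_def)

lemma mat2_eqI:
  assumes "A \<in> carrier_mat 2 2" "B \<in> carrier_mat 2 2"
    and "A $$ (0, 0) = B $$ (0, 0)" "A $$ (0, Suc 0) = B $$ (0, Suc 0)"
    and "A $$ (Suc 0, 0) = B $$ (Suc 0, 0)" "A $$ (Suc 0, Suc 0) = B $$ (Suc 0, Suc 0)"
  shows "A = B"
proof (rule eq_matI)
  fix i j assume "i < dim_row B" "j < dim_col B"
  then have "(i = 0 \<or> i = 1) \<and> (j = 0 \<or> j = 1)"
    using assms(2) by auto
  then show "A $$ (i, j) = B $$ (i, j)"
    using assms by auto
qed (use assms in auto)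

lemma mat2_eq_iff [simp]:
  "mat2 a b c d = mat2 a' b' c' d' \<longleftrightarrow> a = a' \<and> b = b' \<and> c = c' \<and> d = d'"
proof
  assume eq: "mat2 a b c d = mat2 a' b' c' d'"
  show "a = a' \<and> b = b' \<and> c = c' \<and> d = d'"
    using mat2_index[of a b c d] unfolding eq by simp
qed simp

lemma mat2_cases:
  assumes "A \<in> carrier_mat 2 2"
  obtains a b c d where "A = mat2 a b c d"
proof (rule that)
  show "A = mat2 (A $$ (0, 0)) (A $$ (0, Suc 0)) (A $$ (Suc 0, 0)) (A $$ (Suc 0, Suc 0))"
    by (rule mat2_eqI[OF assms]) auto
qed

lemma mat2_mult:
  fixes a b c d :: "'a :: semiring_0"
  shows "mat2 a b c d * mat2 a' b' c' d' =
    mat2 (a * a' + b * c') (a * b' + b * d') (c * a' + d * c') (c * b' + d * d')"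
proof -
  have "{0..<2::nat} = {0, Suc 0}" by auto
  then show ?thesis
    by (intro mat2_eqI mult_carrier_mat[OF mat2_carrier mat2_carrier])
      (simp_all add: scalar_prod_def carrier_matD[OF mat2_carrier])
qed

lemma one_mat_2: "1\<^sub>m 2 = mat2 1 0 0 1"
  by (rule mat2_eqI) auto

lemma smult_mat2: "k \<cdot>\<^sub>m mat2 a b c d = mat2 (k * a) (k * b) (k * c) (k * d)"
  by (rule mat2_eqI) (auto simp: carrier_matD[OF mat2_carrier])

subsection \<open>A free group of matrices\<close>

text \<open>Inverting a unitriangular matrix only changes the sign of its off-diagonal entry, so
  words are evaluated without matrix inversion.\<close>

fun letter_mat2 :: "complex \<Rightarrow> complex \<Rightarrow> artin_gen \<times> bool \<Rightarrow> complex mat" where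
  "letter_mat2 lam mu (Gen_x, e) = mat2 1 0 (if e then lam else - lam) 1"
| "letter_mat2 lam mu (Gen_y, e) = mat2 1 (if e then - mu else mu) 0 1"

lemma letter_mat2_carrier [simp]: "letter_mat2 lam mu l \<in> carrier_mat 2 2"
  by (induction lam mu l rule: letter_mat2.induct) auto

definition word_mat2 :: "complex \<Rightarrow> complex \<Rightarrow> artin_gen word \<Rightarrow> complex mat" where
  "word_mat2 lam mu w = foldr (\<lambda>l M. letter_mat2 lam mu l * M) w (1\<^sub>m 2)"

lemma word_mat2_Nil [simp]: "word_mat2 lam mu [] = 1\<^sub>m 2"
  and word_mat2_Cons: "word_mat2 lam mu (l # w) = letter_mat2 lam mu l * word_mat2 lam mu w"
  by (simp_all add: word_mat2_def)

lemma word_mat2_carrier [simp]: "word_mat2 lam mu w \<in> carrier_mat 2 2"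
  by (induction w) (auto simp: word_mat2_Cons intro!: mult_carrier_mat)

lemma word_mat2_append: "word_mat2 lam mu (u @ v) = word_mat2 lam mu u * word_mat2 lam mu v"
proof (induction u)
  case (Cons l u)
  then show ?case
    using assoc_mult_mat[OF letter_mat2_carrier word_mat2_carrier word_mat2_carrier]
    by (simp add: word_mat2_Cons)
qed (simp add: left_mult_one_mat[OF word_mat2_carrier])

lemma word_mat2_pres_eq:
  assumes "pres_eq {} u v"
  shows "word_mat2 lam mu u = word_mat2 lam mu v"
  using assms
proof induction
  case (cancel a e)
  show ?case
    by (cases a) (auto simp: word_mat2_Cons mat2_mult one_mat_2)
qed (auto simp: word_mat2_append)

text \<open>The determinant is multiplicative and equals 1 on letters. It later separates the power
  of \<open>s\<close> from the value of the word.\<close>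

lemma word_mat2_det_one:
  "\<exists>a b c d. word_mat2 lam mu w = mat2 a b c d \<and> a * d - b * c = 1"
proof (induction w)
  case (Cons l w)
  then obtain a b c d where *: "word_mat2 lam mu w = mat2 a b c d" and det: "a * d - b * c = 1"
    by blast
  show ?case
    using det by (cases "(lam, mu, l)" rule: letter_mat2.cases)
      (auto simp: word_mat2_Cons * mat2_mult algebra_simps)
qed (auto simp: one_mat_2)

section \<open>Ping-pong for two shears\<close>

fun letter_act :: "complex \<Rightarrow> complex \<Rightarrow> artin_gen \<times> bool \<Rightarrow> complex \<times> complex \<Rightarrow> complex \<times> complex" where
  "letter_act lam mu (Gen_x, e) (a, b) = (a, b + (if e then lam else - lam) * a)"
| "letter_act lam mu (Gen_y, e) (a, b) = (a + (if e then - mu else mu) * b, b)"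

text \<open>Links the matrix of a word to its action on the column vector \<open>(a, b)\<close>; the
  last letter acts first.\<close>

lemma foldr_letter_act:
  "word_mat2 lam mu w = mat2 p q r t \<Longrightarrow>
    foldr (letter_act lam mu) w (a, b) = (p * a + q * b, r * a + t * b)"
proof (induction w arbitrary: p q r t)
  case (Cons l w)
  obtain p' q' r' t' where *: "word_mat2 lam mu w = mat2 p' q' r' t'"
    by (rule mat2_cases[OF word_mat2_carrier])
  show ?case
    using Cons.prems Cons.IH[OF *]
    by (cases "(lam, mu, l)" rule: letter_mat2.cases)
      (auto simp: word_mat2_Cons * mat2_mult algebra_simps)
qed (simp add: one_mat_2)

text \<open>Every nontrivial power of the shear that adds \<open>K * a\<close> to \<open>b\<close>
  moves the vector into the open domain where \<open>a\<close> is the smaller coordinate. This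
  weakens \<open>norm b < norm a\<close> so that one start vector can satisfy it for both
  generators.\<close>

definition expelled :: "complex \<Rightarrow> complex \<Rightarrow> complex \<Rightarrow> bool" where
  "expelled K a b \<longleftrightarrow> (\<forall>k::int. k \<noteq> 0 \<longrightarrow> norm a < norm (b + of_int k * K * a))"

text \<open>Remembers the vector from before a whole run of equal letters. The run then counts as
  one power \<open>k\<close> of the shear, whose sign is given by \<open>e\<close>, and adding a
  further equal letter requires no new estimate.\<close>

definition sheared :: "complex \<Rightarrow> bool \<Rightarrow> complex \<Rightarrow> complex \<Rightarrow> bool" where
  "sheared K e a b \<longleftrightarrow>
    (\<exists>(k::int) b0. (if e then k > 0 else k < 0) \<and> b = b0 + of_int k * K * a \<and> expelled K a b0)"

lemma norm_shear_ge:
  fixes K a b :: complex and k :: int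
  assumes "norm K \<ge> 2" and "k \<noteq> 0"
  shows "norm (b + of_int k * K * a) \<ge> 2 * norm a - norm b"
proof -
  have "1 * 2 \<le> \<bar>of_int k :: real\<bar> * norm K"
    using assms by (intro mult_mono) linarith+
  then have "2 * norm a \<le> norm (of_int k * K * a)"
    by (simp add: norm_mult mult_right_mono)
  also have "\<dots> \<le> norm (b + of_int k * K * a) + norm b"
    by (metis add_diff_cancel_left' norm_triangle_ineq4)
  finally show ?thesis by simp
qed

text \<open>By \<open>norm_shear_ge\<close> the new norm is at least
  \<open>2 * norm a - norm b\<close>, which exceeds \<open>norm a\<close>. The strict hypothesis is
  what allows the boundary case \<open>norm K = 2\<close>.\<close>

lemma expelled_if_less: "norm K \<ge> 2 \<Longrightarrow> norm b < norm a \<Longrightarrow> expelled K a b"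
  unfolding expelled_def using norm_shear_ge by (smt (verit))

lemma norm_less_if_sheared: "sheared K e a b \<Longrightarrow> norm a < norm b"
  unfolding sheared_def expelled_def by (metis less_irrefl)

lemma sheared_if_expelled: "expelled K a b \<Longrightarrow> sheared K e a (b + (if e then K else - K) * a)"
  unfolding sheared_def by (intro exI[of _ "if e then 1 else -1"] exI[of _ b]) auto

lemma sheared_again:
  assumes "sheared K e a b"
  shows "sheared K e a (b + (if e then K else - K) * a)"
proof -
  from assms obtain k :: int and b0 where "if e then k > 0 else k < 0"
    "b = b0 + of_int k * K * a" "expelled K a b0"
    unfolding sheared_def by blast
  then show ?thesis
    unfolding sheared_def
    by (intro exI[of _ "if e then k + 1 else k - 1"] exI[of _ b0]) (auto simp: algebra_simps)
qed

text \<open>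
  For \<open>\<bar>K\<bar> = 2\<close> the vector \<open>(1, c)\<close> with \<open>\<bar>c\<bar> = 1\<close> may be sent by a shear to a vector
  that is again on the boundary of the two ping-pong domains, but only if \<open>c = \<plusminus> K / 2\<close>.
\<close>

lemma expelled_unit:
  assumes "norm K \<ge> 2" "norm a = 1" "norm b = 1" "2 * b \<noteq> K * a" "2 * b \<noteq> - K * a"
  shows "expelled K a b"
  unfolding expelled_def
proof (intro allI impI)
  fix k :: int assume k: "k \<noteq> 0"
  show "norm a < norm (b + of_int k * K * a)"
  proof (rule ccontr)
    assume "\<not> ?thesis"
    then have le: "norm (b + of_int k * K * a) \<le> 1" using assms by simp
    have "norm (of_int k * K * a) \<le> norm (b + of_int k * K * a) + norm b"
      by (metis add_diff_cancel_left' norm_triangle_ineq4)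
    then have *: "\<bar>of_int k\<bar> * norm K \<le> 2"
      using le assms by (simp add: norm_mult)
    \<comment> \<open>Because \<open>norm K\<close> is at least 2, the bound \<open>*\<close> leaves
      only \<open>k = 1\<close> or \<open>k = -1\<close>, with \<open>norm K = 2\<close>.\<close>
    have "\<bar>k\<bar> = 1"
    proof (rule ccontr)
      assume "\<bar>k\<bar> \<noteq> 1"
      then have "2 * 2 \<le> \<bar>of_int k :: real\<bar> * norm K"
        using k assms(1) by (intro mult_mono) linarith+
      with * show False by simp
    qed
    define z where "z = of_int k * K * a"
    have z: "norm z = 2"
      using * assms(1,2) \<open>\<bar>k\<bar> = 1\<close> by (auto simp: z_def norm_mult abs_if split: if_splits)
    have bz: "norm (b + z) \<le> 1" using le by (simp add: z_def)
    \<comment> \<open>Parallelogram law for \<open>b + z\<close> and \<open>b\<close>. With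
      \<open>norm z = 2\<close> it leaves no room: \<open>2 * b + z\<close> must vanish.\<close>
    have "norm (2 * b + z) ^ 2 + norm z ^ 2 = 2 * norm (b + z) ^ 2 + 2 * norm b ^ 2"
      unfolding cmod_power2 by (simp add: power2_eq_square algebra_simps)
    moreover have "norm (b + z) ^ 2 \<le> 1"
      using bz by (simp add: power_le_one)
    ultimately have "norm (2 * b + z) ^ 2 \<le> 0"
      unfolding z assms(3) power2_eq_square by linarith
    then have "2 * b + z = 0" by simp
    then show False
      using assms(4,5) \<open>\<bar>k\<bar> = 1\<close>
      by (auto simp: z_def abs_if add_eq_0_iff2 split: if_splits)
  qed
qed

text \<open>Provides the start vector \<open>(1, c)\<close> of the ping-pong. By
  \<open>expelled_unit\<close> at most four values of \<open>c\<close> on the unit circle are bad,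
  so one of any five is good.\<close>

lemma ex_expelled_vector:
  assumes "norm lam \<ge> 2" "norm mu \<ge> 2"
  shows "\<exists>c. norm c = 1 \<and> expelled lam 1 c \<and> expelled (- mu) c 1"
proof -
  \<comment> \<open>The exceptional cases of \<open>expelled_unit\<close>: the first two for the
    shear by \<open>lam\<close>, the last two for the shear by \<open>- mu\<close>, where the
    coordinates are exchanged.\<close>
  let ?B = "{lam / 2, - lam / 2, 2 / mu, - 2 / mu}"
  \<comment> \<open>Five distinct numbers of norm 1; the last one comes from the Pythagorean triple
    3, 4, 5.\<close>
  let ?U = "{1, - 1, \<i>, - \<i>, Complex (3 / 5) (4 / 5)}"
  have "card ?U = 5"
    by (simp add: complex_eq_iff)
  moreover have "card ?B \<le> 4"
    by (simp add: card_insert_if)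
  moreover have "finite ?B" by blast
  ultimately have "\<not> ?U \<subseteq> ?B"
    using card_mono[of ?B ?U] by linarith
  then obtain c where "c \<in> ?U" and cB: "c \<notin> ?B" by (meson subsetI)
  have "norm c = 1"
    using \<open>c \<in> ?U\<close> by (auto simp: cmod_def power2_eq_square)
  note c = this cB
  have mu: "mu \<noteq> 0" using assms by auto
  have "expelled lam 1 c"
    using c assms by (intro expelled_unit) (auto simp: field_simps)
  moreover have "expelled (- mu) c 1"
    using c assms mu minus_equation_iff[of "c * mu" 2]
    by (intro expelled_unit) (auto simp: field_simps)
  ultimately show ?thesis using c by blast
qed

text \<open>The invariant depends on the first letter, which acts last. If the next letter has the
  same generator, it has the same sign because the word is reduced, and the run is prolonged. If the
  generator changes, the strict inequality of the old domain makes the vector expelled for the new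
  shear. A single letter is covered by the choice of \<open>c\<close>.\<close>

lemma ping_pong:
  assumes lam: "norm lam \<ge> 2" and mu: "norm mu \<ge> 2"
    and c: "expelled lam 1 c" "expelled (- mu) c 1"
    and "reduced w"
  shows "case (w, foldr (letter_act lam mu) w (1, c)) of
      ([], v) \<Rightarrow> v = (1, c)
    | ((Gen_x, e) # _, (a, b)) \<Rightarrow> sheared lam e a b
    | ((Gen_y, e) # _, (a, b)) \<Rightarrow> sheared (- mu) e b a"
  using assms(5)
proof (induction w)
  case (Cons l w)
  obtain g e where l: "l = (g, e)" by force
  obtain a b where ab: "foldr (letter_act lam mu) w (1, c) = (a, b)" by force
  have mu': "norm (- mu) \<ge> 2" using mu by simp
  have IH: "case (w, (a, b)) of
      ([], v) \<Rightarrow> v = (1, c)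
    | ((Gen_x, e) # _, (a, b)) \<Rightarrow> sheared lam e a b
    | ((Gen_y, e) # _, (a, b)) \<Rightarrow> sheared (- mu) e b a"
    using Cons by (simp add: l reduced_Cons ab)
  show ?case
  proof (cases w)
    case Nil
    then have "a = 1" "b = c" using IH by auto
    then show ?thesis
      using sheared_if_expelled[OF c(1), of e] sheared_if_expelled[OF c(2), of e]
      by (cases g; cases e) (simp_all add: l ab)
  next
    case (Cons m w')
    obtain h d where m: "m = (h, d)" by force
    have d: "h = g \<Longrightarrow> d = e"
      using Cons.prems by (simp add: l Cons m reduced_Cons)
    show ?thesis
    proof (cases g)
      case Gen_x
      have "sheared lam e a (b + (if e then lam else - lam) * a)"
      proof (cases h)
        case Gen_x
        then show ?thesis using IH d \<open>g = Gen_x\<close> sheared_again[of lam e a b]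
          by (auto simp: Cons m)
      next
        case Gen_y
        then have "norm b < norm a"
          using IH norm_less_if_sheared by (auto simp: Cons m)
        then show ?thesis
          by (intro sheared_if_expelled expelled_if_less lam)
      qed
      then show ?thesis by (simp add: l Gen_x ab)
    next
      case Gen_y
      \<comment> \<open>The form \<open>- (- mu)\<close> is kept so that the facts on shears apply
        literally with \<open>K = - mu\<close>.\<close>
      have "sheared (- mu) e b (a + (if e then - mu else - (- mu)) * b)"
      proof (cases h)
        case Gen_y
        then show ?thesis using IH d \<open>g = Gen_y\<close> sheared_again[of "- mu" e b a]
          by (auto simp: Cons m)
      next
        case Gen_x
        then have "norm a < norm b"
          using IH norm_less_if_sheared by (auto simp: Cons m)
        then show ?thesis
          by (intro sheared_if_expelled expelled_if_less mu')
      qed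
      then show ?thesis by (cases e) (simp_all add: l Gen_y ab)
    qed
  qed
qed simp

text \<open>A nonempty reduced word would send the start vector to one whose coordinates have
  different norms, while \<open>1\<close> and \<open>c\<close> both have norm 1. So the reduced form
  is empty, and free equality carries over to every \<open>R\<close>.\<close>

lemma pres_eq_Nil_if_word_mat2_eq_one:
  assumes "norm lam \<ge> 2" "norm mu \<ge> 2" and "word_mat2 lam mu w = 1\<^sub>m 2"
  shows "pres_eq R w []"
proof -
  obtain v where v: "reduced v" "pres_eq {} w v" using ex_reduced by blast
  obtain c where c: "norm c = 1" "expelled lam 1 c" "expelled (- mu) c 1"
    using ex_expelled_vector[OF assms(1,2)] by blast
  have "word_mat2 lam mu v = mat2 1 0 0 1"
    using word_mat2_pres_eq[OF v(2)] assms(3) by (simp add: one_mat_2)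
  then have "foldr (letter_act lam mu) v (1, c) = (1, c)"
    by (simp add: foldr_letter_act)
  then have "v = []"
    using ping_pong[OF assms(1,2) c(2,3) v(1)] c(1)
    by (auto split: list.splits prod.splits artin_gen.splits dest!: norm_less_if_sheared)
  then show ?thesis
    using v(2) pres_eq_mono by blast
qed

subsection \<open>General linear groups over subrings\<close>

abbreviation complex_subring :: "complex set \<Rightarrow> bool" where
  "complex_subring K \<equiv> subring K (class_ring :: complex ring)"

lemma ring_class_ring: "ring (class_ring :: complex ring)"
  using class_field by (auto simp: field_def domain_def cring_def)

lemma complex_subring_iff:
  "complex_subring K \<longleftrightarrow> 0 \<in> K \<and> 1 \<in> K \<and> (\<forall>a\<in>K. - a \<in> K) \<and>
    (\<forall>a\<in>K. \<forall>b\<in>K. a + b \<in> K \<and> a * b \<in> K)"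
proof -
  have inv: "\<ominus>\<^bsub>class_ring\<^esub> a = - a" for a :: complex
    by (rule abelian_group.minus_equality[OF ring.is_abelian_group[OF ring_class_ring]]) auto
  show ?thesis
  proof
    assume "complex_subring K"
    from subringE[OF this] show "0 \<in> K \<and> 1 \<in> K \<and> (\<forall>a\<in>K. - a \<in> K) \<and>
        (\<forall>a\<in>K. \<forall>b\<in>K. a + b \<in> K \<and> a * b \<in> K)"
      by (simp add: inv)
  qed (rule ring.subringI[OF ring_class_ring], simp_all add: inv)
qed

lemma complex_subring_laurent_ring: "complex_subring (laurent_ring lam mu s)"
  unfolding laurent_ring_def
  by (rule ring.generate_ring_is_subring[OF ring_class_ring]) simp

lemma laurent_ring_gens:
  "{lam, mu, s, inverse s} \<subseteq> laurent_ring lam mu s"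
  unfolding laurent_ring_def by (auto intro: generate_ring.incl)

text \<open>The set that serves as carrier in \<open>GL\<close> before units are taken.\<close>

definition mat_over :: "nat \<Rightarrow> complex set \<Rightarrow> complex mat set" where
  "mat_over m K = {M \<in> carrier_mat m m. elements_mat M \<subseteq> K}"

lemma mat_over_iff:
  "M \<in> mat_over m K \<longleftrightarrow> M \<in> carrier_mat m m \<and> (\<forall>i<m. \<forall>j<m. M $$ (i, j) \<in> K)"
proof
  assume "M \<in> mat_over m K"
  then have M: "M \<in> carrier_mat m m" "elements_mat M \<subseteq> K"
    by (simp_all add: mat_over_def)
  then show "M \<in> carrier_mat m m \<and> (\<forall>i<m. \<forall>j<m. M $$ (i, j) \<in> K)"
    using elements_matI[OF M(1) _ _ HOL.refl] by blast
next
  assume M: "M \<in> carrier_mat m m \<and> (\<forall>i<m. \<forall>j<m. M $$ (i, j) \<in> K)"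
  have "a \<in> K" if "a \<in> elements_mat M" for a
    using elements_matD[OF that] M by auto
  with M show "M \<in> mat_over m K"
    by (auto simp: mat_over_def)
qed

lemma mat_over_carrier: "M \<in> mat_over m K \<Longrightarrow> M \<in> carrier_mat m m"
  by (simp add: mat_over_def)

lemma mat_over_one: "complex_subring K \<Longrightarrow> 1\<^sub>m m \<in> mat_over m K"
  by (auto simp: mat_over_iff complex_subring_iff)

lemma complex_subring_sum: "complex_subring K \<Longrightarrow> (\<And>i. i \<in> I \<Longrightarrow> f i \<in> K) \<Longrightarrow> sum f I \<in> K"
  by (induction I rule: infinite_finite_induct) (auto simp: complex_subring_iff)

lemma mat_over_mult:
  assumes "complex_subring K" "M \<in> mat_over m K" "N \<in> mat_over m K"
  shows "M * N \<in> mat_over m K"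
proof -
  have "(M * N) $$ (i, j) \<in> K" if "i < m" "j < m" for i j
  proof -
    have "(M * N) $$ (i, j) = (\<Sum>k<m. M $$ (i, k) * N $$ (k, j))"
      using mat_over_carrier[OF assms(2)] mat_over_carrier[OF assms(3)] that
      by (simp add: scalar_prod_def atLeast0LessThan)
    also have "\<dots> \<in> K"
      using assms that by (intro complex_subring_sum) (auto simp: mat_over_iff complex_subring_iff)
    finally show ?thesis .
  qed
  moreover have "M * N \<in> carrier_mat m m"
    using assms by (intro mult_carrier_mat) (auto simp: mat_over_iff)
  ultimately show ?thesis by (simp add: mat_over_iff)
qed

lemma mat_over_smult:
  assumes "complex_subring K" "a \<in> K" "M \<in> mat_over m K"
  shows "a \<cdot>\<^sub>m M \<in> mat_over m K"
  using assms by (auto simp: mat_over_iff complex_subring_iff)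

lemma mat_over_pow:
  assumes "complex_subring K" "M \<in> mat_over m K"
  shows "M ^\<^sub>m k \<in> mat_over m K"
proof (induction k)
  case 0
  then show ?case using mat_over_one assms by (auto simp: mat_over_iff)
qed (simp add: mat_over_mult assms)

lemma GL_eq: "GL m K = units_of (ring_mat TYPE(complex) m () \<lparr>carrier := mat_over m K\<rparr>)"
  by (simp add: GL_def mat_over_def)

lemma GL_mult [simp]: "A \<otimes>\<^bsub>GL m K\<^esub> B = A * B"
  and GL_one [simp]: "\<one>\<^bsub>GL m K\<^esub> = 1\<^sub>m m"
  by (simp_all add: GL_eq units_of_def ring_mat_def)

lemma in_carrier_GL_iff: "A \<in> carrier (GL m K) \<longleftrightarrow>
    A \<in> mat_over m K \<and> (\<exists>B\<in>mat_over m K. B * A = 1\<^sub>m m \<and> A * B = 1\<^sub>m m)"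
  by (simp add: GL_eq units_of_def Units_def ring_mat_def)

lemma group_GL:
  assumes "complex_subring K"
  shows "group (GL m K)"
proof -
  have "Group.monoid (ring_mat TYPE(complex) m () \<lparr>carrier := mat_over m K\<rparr>)"
    by (rule monoidI)
      (auto simp: ring_mat_def mat_over_mult mat_over_one assms
        intro: assoc_mult_mat left_mult_one_mat right_mult_one_mat dest!: mat_over_carrier)
  then show ?thesis
    unfolding GL_eq by (rule monoid.units_group)
qed

text \<open>A right inverse over the complex numbers is enough: it coincides with the inverse
  \<open>C\<close> over \<open>K\<close>, because
  \<open>B = (C * A) * B = C * (A * B) = C\<close>.\<close>

lemma GL_inv_eq:
  assumes "complex_subring K" "A \<in> carrier (GL m K)" "B \<in> carrier_mat m m" "A * B = 1\<^sub>m m"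
  shows "inv\<^bsub>GL m K\<^esub> A = B"
proof -
  interpret group "GL m K" by (rule group_GL[OF assms(1)])
  obtain C where C: "C \<in> mat_over m K" "C * A = 1\<^sub>m m" "A * C = 1\<^sub>m m"
    and A: "A \<in> mat_over m K"
    using assms(2) by (auto simp: in_carrier_GL_iff)
  have "B = (C * A) * B" unfolding C(2) using assms(3) by simp
  also have "\<dots> = C * (A * B)"
    by (rule assoc_mult_mat[OF mat_over_carrier[OF C(1)] mat_over_carrier[OF A] assms(3)])
  also have "\<dots> = C"
    unfolding assms(4) by (rule right_mult_one_mat[OF mat_over_carrier[OF C(1)]])
  finally have "B = C" .
  moreover have "C \<in> carrier (GL m K)"
    using C A by (auto simp: in_carrier_GL_iff)
  ultimately show ?thesis
    using inv_equality[of C A] assms(2) C(2) by simp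
qed

subsection \<open>Block monomial matrices\<close>

text \<open>Monomial matrices with 2 by 2 blocks, indexed by rows: block row \<open>i\<close> has
  its only block in column \<open>\<sigma> i\<close>. In a product the index map of the left factor
  is therefore applied first.\<close>

definition block_monomial ::
    "nat \<Rightarrow> (nat \<Rightarrow> nat) \<Rightarrow> (nat \<Rightarrow> 'a :: zero mat) \<Rightarrow> 'a mat" where
  "block_monomial n \<sigma> f = block_mat2 n (\<lambda>i j. if j = \<sigma> i then f i else 0\<^sub>m 2 2)"

lemma block_mat2_carrier [simp]: "block_mat2 n F \<in> carrier_mat (2 * n) (2 * n)"
  by (simp add: block_mat2_def)

lemma block_mat2_index:
  "i < n \<Longrightarrow> j < n \<Longrightarrow> a < 2 \<Longrightarrow> b < 2 \<Longrightarrow>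
    block_mat2 n F $$ (2 * i + a, 2 * j + b) = F i j $$ (a, b)"
  by (simp add: block_mat2_def)

lemma block_eqI:
  assumes M: "M \<in> carrier_mat (2 * n) (2 * n)" and N: "N \<in> carrier_mat (2 * n) (2 * n)"
    and eq: "\<And>i j a b. i < n \<Longrightarrow> j < n \<Longrightarrow> a < 2 \<Longrightarrow> b < 2 \<Longrightarrow>
      M $$ (2 * i + a, 2 * j + b) = N $$ (2 * i + a, 2 * j + b)"
  shows "M = N"
proof (rule eq_matI)
  fix i j assume "i < dim_row N" "j < dim_col N"
  then have "i div 2 < n" "j div 2 < n" using N by auto
  from eq[OF this, of "i mod 2" "j mod 2"] show "M $$ (i, j) = N $$ (i, j)" by simp
qed (use M N in auto)

lemma block_monomial_carrier [simp]: "block_monomial n \<sigma> f \<in> carrier_mat (2 * n) (2 * n)"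
  by (simp add: block_monomial_def)

lemma block_monomial_index:
  "i < n \<Longrightarrow> j < n \<Longrightarrow> a < 2 \<Longrightarrow> b < 2 \<Longrightarrow>
    block_monomial n \<sigma> f $$ (2 * i + a, 2 * j + b) = (if j = \<sigma> i then f i $$ (a, b) else 0)"
  by (simp add: block_monomial_def block_mat2_index)

lemma block_monomial_cong:
  "(\<And>i. i < n \<Longrightarrow> \<sigma> i = \<tau> i) \<Longrightarrow> (\<And>i. i < n \<Longrightarrow> f i = g i) \<Longrightarrow>
    block_monomial n \<sigma> f = block_monomial n \<tau> g"
  by (rule block_eqI[of _ n]) (simp_all add: block_monomial_index)

lemma sum_blocks: "(\<Sum>k<2 * (n::nat). h k) = (\<Sum>p<n. h (2 * p) + h (2 * p + 1))"
  for h :: "nat \<Rightarrow> 'a :: comm_monoid_add"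
  by (induction n) (auto simp: add.assoc)

lemma block_monomial_mult:
  fixes f g :: "nat \<Rightarrow> 'a :: semiring_0 mat"
  assumes \<sigma>: "\<And>i. i < n \<Longrightarrow> \<sigma> i < n"
    and f: "\<And>i. i < n \<Longrightarrow> f i \<in> carrier_mat 2 2" and g: "\<And>i. i < n \<Longrightarrow> g i \<in> carrier_mat 2 2"
  shows "block_monomial n \<sigma> f * block_monomial n \<tau> g =
    block_monomial n (\<lambda>i. \<tau> (\<sigma> i)) (\<lambda>i. f i * g (\<sigma> i))"
proof (rule block_eqI)
  fix i j a b :: nat assume ij: "i < n" "j < n" and ab: "a < 2" "b < 2"
  let ?F = "block_monomial n \<sigma> f" and ?G = "block_monomial n \<tau> g"
  have idx: "2 * i + a < 2 * n" "2 * j + b < 2 * n" using ij ab by auto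
  have two: "{0..<2::nat} = {0, 1}" by auto
  have "(?F * ?G) $$ (2 * i + a, 2 * j + b) =
      (\<Sum>k<2 * n. ?F $$ (2 * i + a, k) * ?G $$ (k, 2 * j + b))"
    using idx by (simp add: scalar_prod_def atLeast0LessThan carrier_matD[OF block_monomial_carrier])
  \<comment> \<open>The inner sum of the matrix product is grouped into blocks \<open>p\<close>;
    only \<open>p = \<sigma> i\<close> contributes.\<close>
  also have "\<dots> = (\<Sum>p<n. if p = \<sigma> i then
      (if j = \<tau> p then f i $$ (a, 0) * g p $$ (0, b) + f i $$ (a, 1) * g p $$ (1, b) else 0) else 0)"
    unfolding sum_blocks
  proof (rule sum.cong)
    fix p assume "p \<in> {..<n}"
    then have p: "p < n" by simp
    show "?F $$ (2 * i + a, 2 * p) * ?G $$ (2 * p, 2 * j + b) +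
        ?F $$ (2 * i + a, 2 * p + 1) * ?G $$ (2 * p + 1, 2 * j + b) =
      (if p = \<sigma> i then
        (if j = \<tau> p then f i $$ (a, 0) * g p $$ (0, b) + f i $$ (a, 1) * g p $$ (1, b) else 0) else 0)"
      using block_monomial_index[OF ij(1) p ab(1), of 0 \<sigma> f]
        block_monomial_index[OF ij(1) p ab(1), of 1 \<sigma> f]
        block_monomial_index[OF p ij(2) _ ab(2), of 0 \<tau> g]
        block_monomial_index[OF p ij(2) _ ab(2), of 1 \<tau> g]
      by simp
  qed simp
  also have "\<dots> = (if j = \<tau> (\<sigma> i) then
      f i $$ (a, 0) * g (\<sigma> i) $$ (0, b) + f i $$ (a, 1) * g (\<sigma> i) $$ (1, b) else 0)"
    using \<sigma>[OF ij(1)] by (simp add: sum.delta')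
  also have "\<dots> = (if j = \<tau> (\<sigma> i) then (f i * g (\<sigma> i)) $$ (a, b) else 0)"
    using f[OF ij(1)] g[OF \<sigma>[OF ij(1)]] ab
    by (simp add: scalar_prod_def two carrier_matD)
  finally show "(?F * ?G) $$ (2 * i + a, 2 * j + b) =
      block_monomial n (\<lambda>i. \<tau> (\<sigma> i)) (\<lambda>i. f i * g (\<sigma> i)) $$ (2 * i + a, 2 * j + b)"
    by (simp add: block_monomial_index ij ab)
qed (auto intro: mult_carrier_mat[OF block_monomial_carrier block_monomial_carrier])

lemma one_smult_mat: "1 \<cdot>\<^sub>m A = (A :: 'a :: semiring_1 mat)"
  by (rule eq_matI) auto

lemma block_monomial_smult_one:
  fixes c :: "'a :: semiring_1"
  shows "block_monomial n (\<lambda>i. i) (\<lambda>_. c \<cdot>\<^sub>m 1\<^sub>m 2) = c \<cdot>\<^sub>m 1\<^sub>m (2 * n)"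
proof (rule block_eqI)
  fix i j a b :: nat assume *: "i < n" "j < n" "a < 2" "b < 2"
  then have "(2 * i + a) div 2 = i" "(2 * i + a) mod 2 = a"
    "(2 * j + b) div 2 = j" "(2 * j + b) mod 2 = b" by auto
  then have "2 * i + a = 2 * j + b \<longleftrightarrow> i = j \<and> a = b" by metis
  moreover have "2 * i + a < 2 * n" "2 * j + b < 2 * n" using * by auto
  ultimately show "block_monomial n (\<lambda>i. i) (\<lambda>_. c \<cdot>\<^sub>m 1\<^sub>m 2) $$ (2 * i + a, 2 * j + b) =
      (c \<cdot>\<^sub>m 1\<^sub>m (2 * n)) $$ (2 * i + a, 2 * j + b)"
    using * by (auto simp: block_monomial_index)
qed auto

lemma block_monomial_one:
  "block_monomial n (\<lambda>i. i) (\<lambda>_. 1\<^sub>m 2 :: 'a :: semiring_1 mat) = 1\<^sub>m (2 * n)"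
  using block_monomial_smult_one[of n "1 :: 'a"] by (simp add: one_smult_mat)

text \<open>Looks at block row 0 only: were \<open>\<sigma> 0\<close> nonzero, the entry at
  \<open>(0, 0)\<close> would be 0 instead of 1.\<close>

lemma block_monomial_eq_oneD:
  fixes f :: "nat \<Rightarrow> 'a :: semiring_1 mat"
  assumes one: "block_monomial n \<sigma> f = 1\<^sub>m (2 * n)"
    and "0 < n" "\<sigma> 0 < n" "f 0 \<in> carrier_mat 2 2" "(1::'a) \<noteq> 0"
  shows "\<sigma> 0 = 0" "f 0 = 1\<^sub>m 2"
proof -
  have *: "(if j = \<sigma> 0 then f 0 $$ (a, b) else 0) = 1\<^sub>m (2 * n) $$ (a, 2 * j + b)"
    if "j < n" "a < 2" "b < 2" for j a b
    using block_monomial_index[OF assms(2) that, of \<sigma> f] by (simp add: one)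
  show \<sigma>: "\<sigma> 0 = 0"
    using *[of 0 0 0] assms(2,5) by (auto split: if_splits)
  show "f 0 = 1\<^sub>m 2"
  proof (rule eq_matI)
    fix a b assume "a < dim_row (1\<^sub>m 2 :: 'a mat)" "b < dim_col (1\<^sub>m 2 :: 'a mat)"
    then show "f 0 $$ (a, b) = 1\<^sub>m 2 $$ (a, b)"
      using *[of 0 a b] assms(2) \<sigma> by (auto split: if_splits)
  qed (use assms(4) in auto)
qed

lemma block_monomial_over:
  assumes "complex_subring K" "\<And>i. i < n \<Longrightarrow> f i \<in> mat_over 2 K"
  shows "block_monomial n \<sigma> f \<in> mat_over (2 * n) K"
proof -
  have "block_monomial n \<sigma> f $$ (i, j) \<in> K" if "i < 2 * n" "j < 2 * n" for i j
  proof -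
    have "i div 2 < n" "j div 2 < n" using that by auto
    from block_monomial_index[OF this, of "i mod 2" "j mod 2" \<sigma> f]
    show ?thesis
      using assms \<open>i div 2 < n\<close> by (auto simp: mat_over_iff complex_subring_iff)
  qed
  then show ?thesis by (simp add: mat_over_iff)
qed

lemma diag_block_mat_replicate:
  fixes A :: "'a :: zero mat"
  assumes A: "A \<in> carrier_mat 2 2"
  shows "diag_block_mat (replicate n A) = block_monomial n (\<lambda>i. i) (\<lambda>_. A)"
proof (induction n)
  case 0
  show ?case by (rule eq_matI) (auto simp: carrier_matD[OF block_monomial_carrier])
next
  case (Suc n)
  let ?B = "block_monomial n (\<lambda>i. i) (\<lambda>_. A)"
  have B: "?B \<in> carrier_mat (2 * n) (2 * n)" by simp
  have "four_block_mat A (0\<^sub>m 2 (2 * n)) (0\<^sub>m (2 * n) 2) ?B = block_monomial (Suc n) (\<lambda>i. i) (\<lambda>_. A)"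
  proof (rule block_eqI[of _ "Suc n"])
    show "four_block_mat A (0\<^sub>m 2 (2 * n)) (0\<^sub>m (2 * n) 2) ?B \<in> carrier_mat (2 * Suc n) (2 * Suc n)"
      using four_block_carrier_mat[OF A B] by simp
    fix i j a b :: nat assume *: "i < Suc n" "j < Suc n" "a < 2" "b < 2"
    show "four_block_mat A (0\<^sub>m 2 (2 * n)) (0\<^sub>m (2 * n) 2) ?B $$ (2 * i + a, 2 * j + b) =
        block_monomial (Suc n) (\<lambda>i. i) (\<lambda>_. A) $$ (2 * i + a, 2 * j + b)"
      using * A B block_monomial_index[of "i - 1" n "j - 1" a b "\<lambda>i. i" "\<lambda>_. A"]
        block_monomial_index[OF *, of "\<lambda>i. i" "\<lambda>_. A"]
      by (cases i; cases j) (simp_all add: four_block_mat_def Let_def carrier_matD carrier_matD[OF block_monomial_carrier])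
  qed (rule block_monomial_carrier)
  then show ?case
    using A by (simp add: Suc Let_def carrier_matD carrier_matD[OF B])
qed

subsection \<open>The representation of the Artin group\<close>

lemma pow_mat_Suc_left:
  assumes "A \<in> carrier_mat m m"
  shows "A ^\<^sub>m Suc k = A * A ^\<^sub>m k"
proof (induction k)
  case (Suc k)
  have "A ^\<^sub>m Suc (Suc k) = (A * A ^\<^sub>m k) * A"
    using Suc by simp
  also have "\<dots> = A * A ^\<^sub>m Suc k"
    using assoc_mult_mat[OF assms pow_carrier_mat[OF assms] assms] by simp
  finally show ?case .
qed (use assms in auto)

lemma pow_mat_mult_inverse:
  fixes A B :: "'a :: semiring_1 mat"
  assumes A: "A \<in> carrier_mat m m" and B: "B \<in> carrier_mat m m" and AB: "A * B = 1\<^sub>m m"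
  shows "A ^\<^sub>m k * B ^\<^sub>m k = 1\<^sub>m m"
proof (induction k)
  case (Suc k)
  have Ak: "A ^\<^sub>m k \<in> carrier_mat m m" and Bk: "B ^\<^sub>m k \<in> carrier_mat m m"
    using A B by auto
  have "A ^\<^sub>m Suc k * B ^\<^sub>m Suc k = (A ^\<^sub>m k * A) * (B * B ^\<^sub>m k)"
    using pow_mat_Suc_left[OF B] by simp
  also have "\<dots> = A ^\<^sub>m k * (A * (B * B ^\<^sub>m k))"
    by (rule assoc_mult_mat[OF Ak A mult_carrier_mat[OF B Bk]])
  also have "A * (B * B ^\<^sub>m k) = B ^\<^sub>m k"
    using assoc_mult_mat[OF A B Bk] AB left_mult_one_mat[OF Bk] by simp
  finally show ?case using Suc by simp
qed (use A B in auto)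

lemma word_mat2_concat_replicate:
  "word_mat2 lam mu (concat (replicate k w)) = word_mat2 lam mu w ^\<^sub>m k"
proof (induction k)
  case (Suc k)
  then show ?case
    using pow_mat_Suc_left[OF word_mat2_carrier, of lam mu w k] by (simp add: word_mat2_append)
qed (simp add: carrier_matD[OF word_mat2_carrier])

lemma smult_mult_smult_mat:
  fixes A B :: "'a :: comm_semiring_1 mat"
  assumes "A \<in> carrier_mat 2 2" "B \<in> carrier_mat 2 2"
  shows "(a \<cdot>\<^sub>m A) * (b \<cdot>\<^sub>m B) = (a * b) \<cdot>\<^sub>m (A * B)"
proof -
  obtain p q r t where A: "A = mat2 p q r t" by (rule mat2_cases[OF assms(1)])
  obtain p' q' r' t' where B: "B = mat2 p' q' r' t'" by (rule mat2_cases[OF assms(2)])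
  show ?thesis by (simp add: A B mat2_mult smult_mat2 algebra_simps)
qed

section \<open>The blocks of the representing matrices and their inverses\<close>

context
  fixes n :: nat and lam mu s :: complex
  assumes n: "2 \<le> n" and s: "s \<noteq> 0"
begin

text \<open>A prime marks the inverse. \<open>M\<close> is \<open>L * A\<close>, the generic block
  of the image of \<open>x y\<close>, and \<open>M'\<close> is the matrix whose power occurs in
  \<open>block_B\<close>.\<close>

private abbreviation (input) "L \<equiv> mat2 1 0 lam 1"
private abbreviation (input) "L' \<equiv> mat2 1 0 (- lam) 1"
private abbreviation (input) "A \<equiv> mat2 1 (- mu) 0 1"
private abbreviation (input) "A' \<equiv> mat2 1 mu 0 1"
private abbreviation (input) "M \<equiv> mat2 1 (- mu) lam (1 - lam * mu)"
private abbreviation (input) "M' \<equiv> mat2 (1 - lam * mu) mu (- lam) 1"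
private abbreviation (input) "B \<equiv> block_B n lam mu s"
private abbreviation (input) "B' \<equiv> inverse s \<cdot>\<^sub>m (M ^\<^sub>m (n - 1) * L)"
private abbreviation (input) "K \<equiv> laurent_ring lam mu s"

lemma pow_M_carrier: "M ^\<^sub>m k \<in> carrier_mat 2 2" "M' ^\<^sub>m k \<in> carrier_mat 2 2"
  by (simp_all add: pow_carrier_mat)

lemma pow_M_inverse: "M ^\<^sub>m k * M' ^\<^sub>m k = 1\<^sub>m 2" "M' ^\<^sub>m k * M ^\<^sub>m k = 1\<^sub>m 2"
  by (intro pow_mat_mult_inverse mat2_carrier, simp add: mat2_mult one_mat_2 algebra_simps)+

lemma B_eq: "B = s \<cdot>\<^sub>m (L' * M' ^\<^sub>m (n - 1))"
  by (simp add: block_B_def)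

lemma block_carriers: "B \<in> carrier_mat 2 2" "B' \<in> carrier_mat 2 2"
  by (auto simp: B_eq intro!: smult_carrier_mat mult_carrier_mat[OF mat2_carrier]
      mult_carrier_mat[OF _ mat2_carrier] pow_M_carrier)

lemma L_inverse: "L * L' = 1\<^sub>m 2" "L' * L = 1\<^sub>m 2" and A_inverse: "A * A' = 1\<^sub>m 2" "A' * A = 1\<^sub>m 2"
  by (simp_all add: mat2_mult one_mat_2)

text \<open>The remaining block of the image of \<open>x y\<close>. The left factor
  \<open>L'\<close> of \<open>B\<close> is there to be cancelled by \<open>L\<close>.\<close>

lemma L_B: "L * B = s \<cdot>\<^sub>m M' ^\<^sub>m (n - 1)"
proof -
  have "L * B = s \<cdot>\<^sub>m (L * (L' * M' ^\<^sub>m (n - 1)))"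
    unfolding B_eq
    by (rule mult_smult_distrib[OF mat2_carrier mult_carrier_mat[OF mat2_carrier pow_M_carrier(2)]])
  also have "L * (L' * M' ^\<^sub>m (n - 1)) = M' ^\<^sub>m (n - 1)"
    using assoc_mult_mat[OF mat2_carrier mat2_carrier pow_M_carrier(2), of 1 0 lam 1 1 0 "- lam" 1]
      L_inverse left_mult_one_mat[OF pow_M_carrier(2)] by simp
  finally show ?thesis .
qed

lemma B_inverse: "B * B' = 1\<^sub>m 2" "B' * B = 1\<^sub>m 2"
proof -
  note c = mult_carrier_mat[OF mat2_carrier pow_M_carrier(2)]
    mult_carrier_mat[OF pow_M_carrier(1) mat2_carrier]
  have "(L' * M' ^\<^sub>m (n - 1)) * (M ^\<^sub>m (n - 1) * L) = L' * (M' ^\<^sub>m (n - 1) * (M ^\<^sub>m (n - 1) * L))"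
    by (rule assoc_mult_mat[OF mat2_carrier pow_M_carrier(2) c(2)])
  also have "M' ^\<^sub>m (n - 1) * (M ^\<^sub>m (n - 1) * L) = L"
    using assoc_mult_mat[OF pow_M_carrier(2) pow_M_carrier(1) mat2_carrier, of "n - 1" "n - 1" 1 0 lam 1]
      left_mult_one_mat[OF mat2_carrier, of 1 0 lam 1] by (metis pow_M_inverse(2))
  finally show "B * B' = 1\<^sub>m 2"
    using s by (simp add: B_eq smult_mult_smult_mat[OF c] L_inverse one_smult_mat)
  have "(M ^\<^sub>m (n - 1) * L) * (L' * M' ^\<^sub>m (n - 1)) = M ^\<^sub>m (n - 1) * (L * (L' * M' ^\<^sub>m (n - 1)))"
    by (rule assoc_mult_mat[OF pow_M_carrier(1) mat2_carrier c(1)])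
  also have "L * (L' * M' ^\<^sub>m (n - 1)) = M' ^\<^sub>m (n - 1)"
    using assoc_mult_mat[OF mat2_carrier mat2_carrier pow_M_carrier(2), of 1 0 lam 1 1 0 "- lam" 1]
      L_inverse left_mult_one_mat[OF pow_M_carrier(2)] by simp
  finally show "B' * B = 1\<^sub>m 2"
    using s by (simp add: B_eq smult_mult_smult_mat[OF c(2,1)] pow_M_inverse one_smult_mat)
qed

private abbreviation (input) "x_inv \<equiv> block_monomial n (\<lambda>i. i) (\<lambda>_. L')"
text \<open>Adding \<open>n - 1\<close> modulo \<open>n\<close> is the backward shift in natural
  numbers. The wrap-around now happens in block row 0, which therefore carries
  \<open>B'\<close>.\<close>

private abbreviation (input) "y_inv \<equiv> block_monomial n (\<lambda>i. (i + (n - 1)) mod n) (\<lambda>i. if i = 0 then B' else A')"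

lemma x_mat_eq: "x_mat n lam = block_monomial n (\<lambda>i. i) (\<lambda>_. L)"
  by (simp add: x_mat_def diag_block_mat_replicate)

lemma y_mat_eq:
  "y_mat n lam mu s = block_monomial n (\<lambda>i. (i + 1) mod n) (\<lambda>i. if i = n - 1 then B else A)"
proof (rule block_eqI)
  fix i j a b :: nat assume ij: "i < n" "j < n" "a < 2" "b < 2"
  \<comment> \<open>For \<open>i = n - 1\<close> the first test \<open>j = i + 1\<close> in
    \<open>y_mat\<close> fails because \<open>j < n\<close>, so the corner block is reached.\<close>
  have "(i + 1) mod n = (if i = n - 1 then 0 else i + 1)"
    using ij(1) by auto
  then show "y_mat n lam mu s $$ (2 * i + a, 2 * j + b) =
      block_monomial n (\<lambda>i. (i + 1) mod n) (\<lambda>i. if i = n - 1 then B else A) $$ (2 * i + a, 2 * j + b)"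
    using ij by (auto simp: y_mat_def block_mat2_index block_monomial_index block_A_def)
qed (simp_all add: y_mat_def)

lemma x_mat_inverse: "x_mat n lam * x_inv = 1\<^sub>m (2 * n)" "x_inv * x_mat n lam = 1\<^sub>m (2 * n)"
  unfolding x_mat_eq by (simp_all add: block_monomial_mult L_inverse block_monomial_one)

lemma y_mat_inverse:
  "y_mat n lam mu s * y_inv = 1\<^sub>m (2 * n)" "y_inv * y_mat n lam mu s = 1\<^sub>m (2 * n)"
proof -
  \<comment> \<open>The two shifts are mutually inverse, and a corner block always meets the other
    corner block.\<close>
  have 1: "(i + 1) mod n = 0 \<longleftrightarrow> i = n - 1" "((i + 1) mod n + (n - 1)) mod n = i"
    "(i + (n - 1)) mod n = n - 1 \<longleftrightarrow> i = 0" "((i + (n - 1)) mod n + 1) mod n = i"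
    if "i < n" for i
  proof -
    show "(i + 1) mod n = 0 \<longleftrightarrow> i = n - 1"
      using that by (cases "i = n - 1") auto
    have "((i + 1) mod n + (n - 1)) mod n = (i + 1 + (n - 1)) mod n"
      by (rule mod_add_left_eq)
    also have "i + 1 + (n - 1) = i + n" using n by simp
    finally show "((i + 1) mod n + (n - 1)) mod n = i"
      using that by simp
    show "(i + (n - 1)) mod n = n - 1 \<longleftrightarrow> i = 0"
    proof (cases i)
      case (Suc k)
      then have "i + (n - 1) = k + n" using that by simp
      then show ?thesis using that Suc by simp
    qed (use that in simp)
    show "((i + (n - 1)) mod n + 1) mod n = i"
      using that by (simp add: mod_simps)
  qed
  have "y_mat n lam mu s * y_inv = block_monomial n (\<lambda>i. ((i + 1) mod n + (n - 1)) mod n)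
      (\<lambda>i. (if i = n - 1 then B else A) * (if (i + 1) mod n = 0 then B' else A'))"
    unfolding y_mat_eq by (rule block_monomial_mult) (use n block_carriers in simp_all)
  also have "\<dots> = block_monomial n (\<lambda>i. i) (\<lambda>_. 1\<^sub>m 2)"
    by (rule block_monomial_cong)
      (auto simp only: 1 B_inverse A_inverse split: if_split)
  finally show "y_mat n lam mu s * y_inv = 1\<^sub>m (2 * n)"
    by (simp add: block_monomial_one)
  have "y_inv * y_mat n lam mu s = block_monomial n (\<lambda>i. ((i + (n - 1)) mod n + 1) mod n)
      (\<lambda>i. (if i = 0 then B' else A') * (if (i + (n - 1)) mod n = n - 1 then B else A))"
    unfolding y_mat_eq by (rule block_monomial_mult) (use n block_carriers in simp_all)
  also have "\<dots> = block_monomial n (\<lambda>i. i) (\<lambda>_. 1\<^sub>m 2)"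
    by (rule block_monomial_cong)
      (auto simp only: 1 B_inverse A_inverse split: if_split)
  finally show "y_inv * y_mat n lam mu s = 1\<^sub>m (2 * n)"
    by (simp add: block_monomial_one)
qed

lemma mat2_over: "{a, b, c, d} \<subseteq> K \<Longrightarrow> mat2 a b c d \<in> mat_over 2 K"
  by (auto simp: mat_over_iff less_2_cases_iff)

lemma blocks_over:
  "L \<in> mat_over 2 K" "L' \<in> mat_over 2 K" "A \<in> mat_over 2 K" "A' \<in> mat_over 2 K"
  "B \<in> mat_over 2 K" "B' \<in> mat_over 2 K"
proof -
  note K = complex_subring_laurent_ring[of lam mu s]
  have k: "0 \<in> K" "1 \<in> K" "lam \<in> K" "mu \<in> K" "- lam \<in> K" "- mu \<in> K"
    "s \<in> K" "inverse s \<in> K"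
    using K laurent_ring_gens[of lam mu s] by (auto simp: complex_subring_iff)
  have "1 - lam * mu = 1 + (- lam) * mu" by simp
  also have "\<dots> \<in> K" using K k by (simp only: complex_subring_iff)
  finally have d: "1 - lam * mu \<in> K" .
  show "L \<in> mat_over 2 K" "L' \<in> mat_over 2 K" "A \<in> mat_over 2 K" "A' \<in> mat_over 2 K"
    using k by (auto intro!: mat2_over)
  then show "B \<in> mat_over 2 K" "B' \<in> mat_over 2 K"
    unfolding B_eq using k d
    by (auto intro!: mat_over_smult mat_over_mult mat_over_pow K mat2_over)
qed

lemma x_mat_GL: "x_mat n lam \<in> carrier (GL (2 * n) K)"
  and y_mat_GL: "y_mat n lam mu s \<in> carrier (GL (2 * n) K)"
proof -
  have over: "block_monomial n \<sigma> f \<in> mat_over (2 * n) K" if "\<And>i. f i \<in> mat_over 2 K" for \<sigma> f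
    by (rule block_monomial_over[OF complex_subring_laurent_ring that])
  show "x_mat n lam \<in> carrier (GL (2 * n) K)"
    unfolding in_carrier_GL_iff
  proof
    show "x_mat n lam \<in> mat_over (2 * n) K"
      unfolding x_mat_eq by (intro over blocks_over)
    show "\<exists>N\<in>mat_over (2 * n) K. N * x_mat n lam = 1\<^sub>m (2 * n) \<and> x_mat n lam * N = 1\<^sub>m (2 * n)"
      using over[of "\<lambda>_. L'"] blocks_over x_mat_inverse by blast
  qed
  show "y_mat n lam mu s \<in> carrier (GL (2 * n) K)"
    unfolding in_carrier_GL_iff
  proof
    show "y_mat n lam mu s \<in> mat_over (2 * n) K"
      unfolding y_mat_eq by (intro over) (simp add: blocks_over)
    have "y_inv \<in> mat_over (2 * n) K"
      by (intro over) (use blocks_over in \<open>simp del: One_nat_def\<close>)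
    then show "\<exists>N\<in>mat_over (2 * n) K. N * y_mat n lam mu s = 1\<^sub>m (2 * n) \<and>
        y_mat n lam mu s * N = 1\<^sub>m (2 * n)"
      using y_mat_inverse by blast
  qed
qed

text \<open>
  Conjugating by \<open>diag (1, M, \<dots>, M\<^sup>n\<^sup>-\<^sup>1)\<close> turns \<open>x y\<close> into the cyclic block shift with the single
  scalar \<open>s\<close> at the wrap-around; each wrap of the shifted index contributes one factor \<open>s\<close>.
\<close>

lemma xy_pow:
  "(x_mat n lam \<otimes>\<^bsub>GL (2 * n) K\<^esub> y_mat n lam mu s) [^]\<^bsub>GL (2 * n) K\<^esub> k =
    block_monomial n (\<lambda>i. (i + k) mod n)
      (\<lambda>i. s ^ ((i + k) div n) \<cdot>\<^sub>m (M' ^\<^sub>m i * M ^\<^sub>m ((i + k) mod n)))"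
proof (induction k)
  case 0
  interpret group "GL (2 * n) K"
    by (rule group_GL[OF complex_subring_laurent_ring])
  have "block_monomial n (\<lambda>i. (i + 0) mod n)
      (\<lambda>i. s ^ ((i + 0) div n) \<cdot>\<^sub>m (M' ^\<^sub>m i * M ^\<^sub>m ((i + 0) mod n))) =
      block_monomial n (\<lambda>i. i) (\<lambda>_. 1 \<cdot>\<^sub>m 1\<^sub>m 2)"
    by (rule block_monomial_cong) (simp_all add: pow_M_inverse)
  then show ?case
    by (simp add: one_smult_mat block_monomial_one)
next
  case (Suc k)
  interpret group "GL (2 * n) K"
    by (rule group_GL[OF complex_subring_laurent_ring])
  \<comment> \<open>The blocks of the image of \<open>x y\<close>: \<open>L * A = M\<close>, except
    in the last block row, where \<open>L_B\<close> applies.\<close>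
  define g where "g i = (if i = n - 1 then s \<cdot>\<^sub>m M' ^\<^sub>m (n - 1) else M)" for i
  have LA: "L * A = M" by (simp add: mat2_mult)
  have xy: "x_mat n lam * y_mat n lam mu s = block_monomial n (\<lambda>i. (i + 1) mod n) g"
    unfolding x_mat_eq y_mat_eq
    by (subst block_monomial_mult)
      (auto simp: block_carriers L_B g_def LA intro!: block_monomial_cong)
  have g: "g i \<in> carrier_mat 2 2" for i
    by (simp add: g_def pow_M_carrier)
  let ?f = "\<lambda>k i. s ^ ((i + k) div n) \<cdot>\<^sub>m (M' ^\<^sub>m i * M ^\<^sub>m ((i + k) mod n))"
  have f: "?f k i \<in> carrier_mat 2 2" for i
    by (intro smult_carrier_mat mult_carrier_mat[OF pow_M_carrier(2) pow_M_carrier(1)])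
  \<comment> \<open>With \<open>q\<close> wraps so far and current position \<open>r\<close>, a
    further factor either appends one \<open>M\<close> or, at \<open>r = n - 1\<close>, cancels
    \<open>M ^\<^sub>m r\<close> completely and contributes one more \<open>s\<close>.\<close>
  have step: "?f k i * g ((i + k) mod n) = ?f (Suc k) i" if "i < n" for i
  proof -
    define q r where "q = (i + k) div n" and "r = (i + k) mod n"
    have n0: "n \<noteq> 0" using n by simp
    have ik: "i + k = q * n + r" and r: "r < n"
      using n by (simp_all add: q_def r_def)
    note c = mult_carrier_mat[OF pow_M_carrier(2) pow_M_carrier(1)]
    show ?thesis
    proof (cases "r = n - 1")
      case True
      then have "i + Suc k = (q + 1) * n" using ik n by simp
      then have qr: "(i + Suc k) div n = Suc q" "(i + Suc k) mod n = 0"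
        using n by (simp_all del: add_Suc_right)
      have "?f k i * g r = (s ^ q * s) \<cdot>\<^sub>m (M' ^\<^sub>m i * M ^\<^sub>m r * M' ^\<^sub>m r)"
        using smult_mult_smult_mat[OF c pow_M_carrier(2), of "s ^ q" i r s r]
        by (simp add: g_def True flip: q_def r_def)
      also have "M' ^\<^sub>m i * M ^\<^sub>m r * M' ^\<^sub>m r = M' ^\<^sub>m i * 1\<^sub>m 2"
        using assoc_mult_mat[OF pow_M_carrier(2) pow_M_carrier(1) pow_M_carrier(2), of i r r]
        by (simp add: pow_M_inverse)
      finally show ?thesis
        by (simp add: qr carrier_matD[OF mat2_carrier] mult.commute del: add_Suc_right flip: r_def)
    next
      case False
      then have eq: "i + Suc k = Suc r + q * n" and "Suc r < n" using ik r n by auto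
      then have qr: "(i + Suc k) div n = q" "(i + Suc k) mod n = Suc r"
        unfolding eq using n
        by (simp_all only: div_mult_self1[OF n0] mod_mult_self1 div_less mod_less add_0_right)
      have "?f k i * g r = s ^ q \<cdot>\<^sub>m (M' ^\<^sub>m i * M ^\<^sub>m r * M)"
        using mult_smult_assoc_mat[OF c mat2_carrier] False
        by (simp add: g_def flip: q_def r_def)
      also have "M' ^\<^sub>m i * M ^\<^sub>m r * M = M' ^\<^sub>m i * M ^\<^sub>m Suc r"
        using assoc_mult_mat[OF pow_M_carrier(2) pow_M_carrier(1) mat2_carrier] by simp
      finally show ?thesis
        by (simp add: qr del: add_Suc_right flip: r_def)
    qed
  qed
  have "(x_mat n lam \<otimes>\<^bsub>GL (2 * n) K\<^esub> y_mat n lam mu s) [^]\<^bsub>GL (2 * n) K\<^esub> Suc k =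
      block_monomial n (\<lambda>i. (i + k) mod n) (?f k) * block_monomial n (\<lambda>i. (i + 1) mod n) g"
    using Suc by (simp add: xy)
  also have "\<dots> = block_monomial n (\<lambda>i. ((i + k) mod n + 1) mod n) (\<lambda>i. ?f k i * g ((i + k) mod n))"
    using n by (intro block_monomial_mult f g) auto
  also have "\<dots> = block_monomial n (\<lambda>i. (i + Suc k) mod n) (?f (Suc k))"
    by (rule block_monomial_cong) (simp_all only: step, simp add: mod_simps)
  finally show ?case .
qed

text \<open>After \<open>n\<close> steps every index is back at its start and has wrapped exactly
  once, so the powers of \<open>M'\<close> and \<open>M\<close> cancel and one factor
  \<open>s\<close> remains.\<close>

lemma xy_pow_n:
  "(x_mat n lam \<otimes>\<^bsub>GL (2 * n) K\<^esub> y_mat n lam mu s) [^]\<^bsub>GL (2 * n) K\<^esub> n = s \<cdot>\<^sub>m 1\<^sub>m (2 * n)"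
proof -
  have "(i + n) div n = 1" if "i < n" for i
    using that by (simp add: div_add_self2)
  then show ?thesis
    unfolding xy_pow block_monomial_smult_one[symmetric]
    by (intro block_monomial_cong) (simp_all add: pow_M_inverse)
qed

lemma ex_representation:
  "\<exists>\<rho>\<in>hom (artin_group n) (GL (2 * n) K).
    \<rho> (artin_x n) = x_mat n lam \<and> \<rho> (artin_y n) = y_mat n lam mu s"
proof -
  interpret group "GL (2 * n) K"
    by (rule group_GL[OF complex_subring_laurent_ring])
  let ?X = "x_mat n lam" and ?Y = "y_mat n lam mu s"
  define h where "h g = (case g of Gen_x \<Rightarrow> ?X | Gen_y \<Rightarrow> ?Y)" for g
  have h: "range h \<subseteq> carrier (GL (2 * n) K)"
    using x_mat_GL y_mat_GL by (auto simp: h_def split: artin_gen.splits)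
  have X: "?X \<in> carrier_mat (2 * n) (2 * n)" and Y: "?Y \<in> carrier_mat (2 * n) (2 * n)"
    by (simp_all add: x_mat_eq y_mat_eq)
  \<comment> \<open>\<open>X (Y X)^n = (X Y)^n X = X (X Y)^n\<close>, the last step because
    \<open>(X Y)^n\<close> is scalar; cancelling \<open>X\<close> on the left gives the
    relation.\<close>
  have "?X \<otimes>\<^bsub>GL (2 * n) K\<^esub> (?Y \<otimes>\<^bsub>GL (2 * n) K\<^esub> ?X) [^]\<^bsub>GL (2 * n) K\<^esub> n =
      (?X \<otimes>\<^bsub>GL (2 * n) K\<^esub> ?Y) [^]\<^bsub>GL (2 * n) K\<^esub> n \<otimes>\<^bsub>GL (2 * n) K\<^esub> ?X"
    by (rule pow_mult_swap[OF x_mat_GL y_mat_GL])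
  also have "\<dots> = ?X \<otimes>\<^bsub>GL (2 * n) K\<^esub> (?X \<otimes>\<^bsub>GL (2 * n) K\<^esub> ?Y) [^]\<^bsub>GL (2 * n) K\<^esub> n"
    unfolding xy_pow_n using mult_smult_distrib[OF X one_carrier_mat] mult_smult_assoc_mat[OF one_carrier_mat X]
      left_mult_one_mat[OF X] right_mult_one_mat[OF X] by simp
  finally have "(?X \<otimes>\<^bsub>GL (2 * n) K\<^esub> ?Y) [^]\<^bsub>GL (2 * n) K\<^esub> n =
      (?Y \<otimes>\<^bsub>GL (2 * n) K\<^esub> ?X) [^]\<^bsub>GL (2 * n) K\<^esub> n"
    using x_mat_GL y_mat_GL by (metis Units_eq Units_l_cancel m_closed nat_pow_closed)
  then have "word_eval (GL (2 * n) K) h u = word_eval (GL (2 * n) K) h v"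
    if "(u, v) \<in> artin_relations n" for u v
    using that x_mat_GL y_mat_GL r_one[OF x_mat_GL] r_one[OF y_mat_GL]
    by (simp add: artin_relations_def word_eval_concat_replicate[OF h] h_def)
  from ex_hom_presented_group[OF h this] obtain \<rho>
    where "\<rho> \<in> hom (artin_group n) (GL (2 * n) K)"
      and "\<And>w. \<rho> (pres_class (artin_relations n) w) = word_eval (GL (2 * n) K) h w"
    by (auto simp: artin_group_def)
  then show ?thesis
    using r_one[OF x_mat_GL] r_one[OF y_mat_GL]
    by (intro bexI[of _ \<rho>]) (simp_all add: artin_x_def artin_y_def h_def)
qed


section \<open>The central element \<open>z\<close> of the Artin group\<close>

private abbreviation (input) "G \<equiv> artin_group n"
private abbreviation (input) "cls \<equiv> pres_class (artin_relations n)"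
private abbreviation (input) "z \<equiv> cls (concat (replicate n [(Gen_x, True), (Gen_y, True)]))"

lemma group_G: "group G"
  by (simp add: artin_group_def group_presented_group)

lemma cls_carrier: "cls w \<in> carrier G"
  by (simp add: artin_group_def pres_class_in_carrier)

lemma cls_append: "cls (u @ v) = cls u \<otimes>\<^bsub>G\<^esub> cls v"
  by (simp add: artin_group_def presented_group_mult)

lemma cls_Nil: "cls [] = \<one>\<^bsub>G\<^esub>"
  by (simp add: artin_group_def pres_class_Nil)

lemma cls_inv: "cls [(a, False)] = inv\<^bsub>G\<^esub> cls [(a, True)]"
  by (simp add: artin_group_def pres_class_inv_letter)

lemma cls_power: "cls (concat (replicate k w)) = cls w [^]\<^bsub>G\<^esub> k"
  by (simp add: artin_group_def pres_class_concat_replicate)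

lemma cls_pair: "cls [l, m] = cls [l] \<otimes>\<^bsub>G\<^esub> cls [m]"
  using cls_append[of "[l]" "[m]"] by simp

text \<open>By the defining relation \<open>z\<close> is both \<open>(x y)^n\<close> and
  \<open>(y x)^n\<close>, so \<open>pow_mult_swap\<close> lets it pass either generator. Inverse
  letters follow by conjugation, and words by induction.\<close>

lemma z_central: "z \<otimes>\<^bsub>G\<^esub> cls w = cls w \<otimes>\<^bsub>G\<^esub> z"
proof (induction w)
  case Nil
  interpret group G by (rule group_G)
  show ?case by (simp add: cls_Nil cls_carrier)
next
  case (Cons l w)
  interpret group G by (rule group_G)
  let ?x = "cls [(Gen_x, True)]" and ?y = "cls [(Gen_y, True)]"
  have z: "z = (?x \<otimes>\<^bsub>G\<^esub> ?y) [^]\<^bsub>G\<^esub> n"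
    by (simp add: cls_power cls_pair)
  have z': "z = (?y \<otimes>\<^bsub>G\<^esub> ?x) [^]\<^bsub>G\<^esub> n"
  proof -
    have "z = cls (concat (replicate n [(Gen_y, True), (Gen_x, True)]))"
      unfolding pres_class_eq_iff
      by (rule pres_eq.relation) (simp add: artin_relations_def)
    then show ?thesis by (simp add: cls_power cls_pair)
  qed
  have pos: "z \<otimes>\<^bsub>G\<^esub> cls [(a, True)] = cls [(a, True)] \<otimes>\<^bsub>G\<^esub> z" for a
  proof (cases a)
    case Gen_x
    then show ?thesis
      using pow_mult_swap[OF cls_carrier cls_carrier, of "[(Gen_x, True)]" "[(Gen_y, True)]" n]
      by (simp flip: z z')
  next
    case Gen_y
    then show ?thesis
      using pow_mult_swap[OF cls_carrier cls_carrier, of "[(Gen_y, True)]" "[(Gen_x, True)]" n]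
      by (simp flip: z z')
  qed
  obtain a e where l: "l = (a, e)" by force
  have "z \<otimes>\<^bsub>G\<^esub> cls [l] = cls [l] \<otimes>\<^bsub>G\<^esub> z"
  proof (cases e)
    case False
    let ?a = "cls [(a, True)]"
    have "inv\<^bsub>G\<^esub> ?a \<otimes>\<^bsub>G\<^esub> z = inv\<^bsub>G\<^esub> ?a \<otimes>\<^bsub>G\<^esub> (z \<otimes>\<^bsub>G\<^esub> ?a) \<otimes>\<^bsub>G\<^esub> inv\<^bsub>G\<^esub> ?a"
      by (simp add: m_assoc cls_carrier)
    also have "\<dots> = inv\<^bsub>G\<^esub> ?a \<otimes>\<^bsub>G\<^esub> (?a \<otimes>\<^bsub>G\<^esub> z) \<otimes>\<^bsub>G\<^esub> inv\<^bsub>G\<^esub> ?a"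
      by (simp only: pos)
    also have "\<dots> = z \<otimes>\<^bsub>G\<^esub> inv\<^bsub>G\<^esub> ?a"
      by (simp add: cls_carrier flip: m_assoc)
    finally have "inv\<^bsub>G\<^esub> ?a \<otimes>\<^bsub>G\<^esub> z = z \<otimes>\<^bsub>G\<^esub> inv\<^bsub>G\<^esub> ?a" .
    then show ?thesis
      by (simp add: l False cls_inv)
  qed (simp add: l pos)
  then show ?case
    using Cons cls_append[of "[l]" w] by (simp only: append.simps) (metis cls_carrier m_assoc)
qed

lemma z_pow_central: "z [^]\<^bsub>G\<^esub> (k::nat) \<otimes>\<^bsub>G\<^esub> cls w = cls w \<otimes>\<^bsub>G\<^esub> z [^]\<^bsub>G\<^esub> k"
proof -
  interpret group G by (rule group_G)
  show ?thesis
    by (rule group_commutes_pow[OF z_central cls_carrier cls_carrier])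
qed

section \<open>Faithfulness of every homomorphism with the prescribed values on the
  generators\<close>

context
  fixes \<rho>
  assumes \<rho>: "\<rho> \<in> hom G (GL (2 * n) K)"
    and \<rho>_x: "\<rho> (artin_x n) = x_mat n lam" and \<rho>_y: "\<rho> (artin_y n) = y_mat n lam mu s"
begin

lemma group_hom_rho: "group_hom G (GL (2 * n) K) \<rho>"
  using \<rho> group_G group_GL[OF complex_subring_laurent_ring]
  by (simp add: group_hom_def group_hom_axioms_def)

lemma rho_letters:
  "\<rho> (cls [(Gen_x, True)]) = block_monomial n (\<lambda>i. i) (\<lambda>_. L)"
  "\<rho> (cls [(Gen_x, False)]) = x_inv"
  "\<rho> (cls [(Gen_y, True)]) = block_monomial n (\<lambda>i. (i + 1) mod n) (\<lambda>i. if i = n - 1 then B else A)"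
  "\<rho> (cls [(Gen_y, False)]) = y_inv"
proof -
  interpret group_hom G "GL (2 * n) K" \<rho> by (rule group_hom_rho)
  have x: "\<rho> (cls [(Gen_x, True)]) = x_mat n lam" and y: "\<rho> (cls [(Gen_y, True)]) = y_mat n lam mu s"
    using \<rho>_x \<rho>_y by (simp_all add: artin_x_def artin_y_def)
  show "\<rho> (cls [(Gen_x, True)]) = block_monomial n (\<lambda>i. i) (\<lambda>_. L)"
    by (simp only: x x_mat_eq)
  show "\<rho> (cls [(Gen_y, True)]) =
      block_monomial n (\<lambda>i. (i + 1) mod n) (\<lambda>i. if i = n - 1 then B else A)"
    by (simp only: y y_mat_eq)
  show "\<rho> (cls [(Gen_x, False)]) = x_inv"
    using hom_inv[OF cls_carrier]
      GL_inv_eq[OF complex_subring_laurent_ring x_mat_GL block_monomial_carrier x_mat_inverse(1)]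
    by (simp only: cls_inv x)
  show "\<rho> (cls [(Gen_y, False)]) = y_inv"
    using hom_inv[OF cls_carrier]
      GL_inv_eq[OF complex_subring_laurent_ring y_mat_GL block_monomial_carrier y_mat_inverse(1)]
    by (simp only: cls_inv y)
qed

text \<open>
  The nonzero block in each block row of the image of a letter is, up to a power of \<open>s\<close>, the value
  of a word under \<open>x \<mapsto> L\<close>, \<open>y \<mapsto> A\<close> that represents the letter up to a power of the central
  element \<open>z\<close>. Exponents are put on both sides so that they can be natural numbers.
\<close>

lemma letter_image:
  "\<exists>\<tau> g. \<rho> (cls [l]) = block_monomial n \<tau> g \<and>
    (\<forall>e<n. \<tau> e < n \<and> g e \<in> carrier_mat 2 2 \<and>
      (\<exists>p q w. s ^ p \<cdot>\<^sub>m g e = s ^ q \<cdot>\<^sub>m word_mat2 lam mu w \<and>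
        z [^]\<^bsub>G\<^esub> p \<otimes>\<^bsub>G\<^esub> cls [l] = z [^]\<^bsub>G\<^esub> q \<otimes>\<^bsub>G\<^esub> cls w))"
proof -
  interpret group G by (rule group_G)
  have word1: "word_mat2 lam mu [m] = letter_mat2 lam mu m" for m
    using right_mult_one_mat[OF letter_mat2_carrier] by (simp add: word_mat2_Cons)
  \<comment> \<open>The blocks \<open>L\<close>, \<open>L'\<close>, \<open>A\<close>,
    \<open>A'\<close> are values of letters, with both exponents 0. Only \<open>B\<close> and
    \<open>B'\<close> require a power of \<open>z\<close>.\<close>
  have triv: "\<exists>p q w. s ^ p \<cdot>\<^sub>m letter_mat2 lam mu m = s ^ q \<cdot>\<^sub>m word_mat2 lam mu w \<and>
      z [^]\<^bsub>G\<^esub> p \<otimes>\<^bsub>G\<^esub> cls [m] = z [^]\<^bsub>G\<^esub> q \<otimes>\<^bsub>G\<^esub> cls w" for m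
    by (intro exI[of _ 0] exI[of _ "[m]"]) (simp add: word1)
  let ?x = "cls [(Gen_x, True)]" and ?y = "cls [(Gen_y, True)]"
  have z: "z = (?x \<otimes>\<^bsub>G\<^esub> ?y) [^]\<^bsub>G\<^esub> (n - 1) \<otimes>\<^bsub>G\<^esub> (?x \<otimes>\<^bsub>G\<^esub> ?y)"
    using n by (simp add: cls_power cls_pair flip: nat_pow_Suc)
  consider "l = (Gen_x, True)" | "l = (Gen_x, False)" | "l = (Gen_y, True)" | "l = (Gen_y, False)"
    by (cases l) (metis artin_gen.exhaust)
  then show ?thesis
  proof cases
    case 1
    show ?thesis
      unfolding 1 using rho_letters(1) triv[of "(Gen_x, True)"]
      by (intro exI[of _ "\<lambda>i. i"] exI[of _ "\<lambda>_. L"]) simp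
  next
    case 2
    show ?thesis
      unfolding 2 using rho_letters(2) triv[of "(Gen_x, False)"]
      by (intro exI[of _ "\<lambda>i. i"] exI[of _ "\<lambda>_. L'"]) simp
  next
    case 3
    \<comment> \<open>Read off from
      \<open>B = s \<cdot>\<^sub>m (L' * M' ^\<^sub>m (n - 1))\<close>. In the group this word is
      \<open>z\<close> to the power -1 times \<open>y\<close>, so one \<open>z\<close> on the
      right-hand side matches the one \<open>s\<close>.\<close>
    define w where "w = (Gen_x, False) # concat (replicate (n - 1) [(Gen_y, False), (Gen_x, False)])"
    have "word_mat2 lam mu [(Gen_y, False), (Gen_x, False)] = M'"
      by (simp add: word_mat2_Cons one_mat_2 mat2_mult)
    then have "word_mat2 lam mu w = L' * M' ^\<^sub>m (n - 1)"
      by (simp add: w_def word_mat2_Cons word_mat2_concat_replicate)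
    then have mat: "B = s \<cdot>\<^sub>m word_mat2 lam mu w"
      by (simp add: B_eq)
    have "cls w = inv\<^bsub>G\<^esub> ?x \<otimes>\<^bsub>G\<^esub> inv\<^bsub>G\<^esub> ((?x \<otimes>\<^bsub>G\<^esub> ?y) [^]\<^bsub>G\<^esub> (n - 1))"
      using cls_append[of "[(Gen_x, False)]"]
      by (simp add: w_def cls_power cls_pair cls_inv cls_carrier nat_pow_inv flip: inv_mult_group)
    then have "cls w \<otimes>\<^bsub>G\<^esub> z = ?y"
      by (simp add: z cls_carrier inv_mult_group m_assoc inv_solve_left')
    then have zw: "z \<otimes>\<^bsub>G\<^esub> cls w = ?y" by (simp only: z_central)
    have B: "\<exists>p q w. s ^ p \<cdot>\<^sub>m B = s ^ q \<cdot>\<^sub>m word_mat2 lam mu w \<and>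
        z [^]\<^bsub>G\<^esub> p \<otimes>\<^bsub>G\<^esub> ?y = z [^]\<^bsub>G\<^esub> q \<otimes>\<^bsub>G\<^esub> cls w"
      by (rule exI[of _ 0], rule exI[of _ 1], rule exI[of _ w])
        (simp add: mat zw one_smult_mat cls_carrier)
    show ?thesis
      unfolding 3 using n rho_letters(3) triv[of "(Gen_y, True)"] B block_carriers
      by (intro exI[of _ "\<lambda>i. (i + 1) mod n"] exI[of _ "\<lambda>i. if i = n - 1 then B else A"]) simp
  next
    case 4
    \<comment> \<open>Read off from \<open>B'\<close>. Since \<open>z = w y\<close> in the group,
      the exponent 1 now stands on the side of the letter.\<close>
    define w where "w = concat (replicate (n - 1) [(Gen_x, True), (Gen_y, True)]) @ [(Gen_x, True)]"
    have "word_mat2 lam mu [(Gen_x, True), (Gen_y, True)] = M"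
      by (simp add: word_mat2_Cons one_mat_2 mat2_mult)
    then have "word_mat2 lam mu w = M ^\<^sub>m (n - 1) * L"
      by (simp add: w_def word_mat2_append word1 word_mat2_concat_replicate)
    then have mat: "s \<cdot>\<^sub>m B' = word_mat2 lam mu w"
      using s by (auto intro!: eq_matI)
    have "cls w = (?x \<otimes>\<^bsub>G\<^esub> ?y) [^]\<^bsub>G\<^esub> (n - 1) \<otimes>\<^bsub>G\<^esub> ?x"
      by (simp add: w_def cls_append cls_power cls_pair)
    then have zw: "z \<otimes>\<^bsub>G\<^esub> inv\<^bsub>G\<^esub> ?y = cls w"
      by (simp add: z cls_carrier m_assoc)
    have B': "\<exists>p q w. s ^ p \<cdot>\<^sub>m B' = s ^ q \<cdot>\<^sub>m word_mat2 lam mu w \<and>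
        z [^]\<^bsub>G\<^esub> p \<otimes>\<^bsub>G\<^esub> cls [(Gen_y, False)] = z [^]\<^bsub>G\<^esub> q \<otimes>\<^bsub>G\<^esub> cls w"
      by (rule exI[of _ 1], rule exI[of _ 0], rule exI[of _ w])
        (simp add: mat zw one_smult_mat cls_carrier cls_inv del: One_nat_def)
    show ?thesis
      unfolding 4 using n rho_letters(4) triv[of "(Gen_y, False)"] B' block_carriers
      by (intro exI[of _ "\<lambda>i. (i + (n - 1)) mod n"] exI[of _ "\<lambda>i. if i = 0 then B' else A'"]) simp
  qed
qed

text \<open>Induction from the right end: a letter appended to \<open>u\<close> multiplies the block
  of row 0 by the block that the letter has in row \<open>\<sigma> 0\<close>. That block comes with
  a word by \<open>letter_image\<close>, and centrality of \<open>z\<close> lets the powers be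
  collected in front.\<close>

lemma word_image:
  "\<exists>\<sigma> f p q v. \<rho> (cls u) = block_monomial n \<sigma> f \<and>
    (\<forall>i<n. \<sigma> i < n \<and> f i \<in> carrier_mat 2 2) \<and>
    s ^ p \<cdot>\<^sub>m f 0 = s ^ q \<cdot>\<^sub>m word_mat2 lam mu v \<and>
    z [^]\<^bsub>G\<^esub> p \<otimes>\<^bsub>G\<^esub> cls u = z [^]\<^bsub>G\<^esub> q \<otimes>\<^bsub>G\<^esub> cls v"
proof (induction u rule: rev_induct)
  case Nil
  interpret group_hom G "GL (2 * n) K" \<rho> by (rule group_hom_rho)
  have "\<rho> (cls []) = block_monomial n (\<lambda>i. i) (\<lambda>_. 1\<^sub>m 2)"
    by (simp add: cls_Nil block_monomial_one)
  then show ?case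
    by (intro exI[of _ "\<lambda>i. i"] exI[of _ "\<lambda>_. 1\<^sub>m 2"] exI[of _ 0] exI[of _ "[]"]) simp
next
  case (snoc l u)
  interpret group_hom G "GL (2 * n) K" \<rho> by (rule group_hom_rho)
  obtain \<sigma> f p q v where u: "\<rho> (cls u) = block_monomial n \<sigma> f"
    and \<sigma>: "\<And>i. i < n \<Longrightarrow> \<sigma> i < n" and f: "\<And>i. i < n \<Longrightarrow> f i \<in> carrier_mat 2 2"
    and f0: "s ^ p \<cdot>\<^sub>m f 0 = s ^ q \<cdot>\<^sub>m word_mat2 lam mu v"
    and zu: "z [^]\<^bsub>G\<^esub> p \<otimes>\<^bsub>G\<^esub> cls u = z [^]\<^bsub>G\<^esub> q \<otimes>\<^bsub>G\<^esub> cls v"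
    using snoc by blast
  obtain \<tau> g where l: "\<rho> (cls [l]) = block_monomial n \<tau> g"
    and *: "\<forall>e<n. \<tau> e < n \<and> g e \<in> carrier_mat 2 2 \<and>
      (\<exists>p q w. s ^ p \<cdot>\<^sub>m g e = s ^ q \<cdot>\<^sub>m word_mat2 lam mu w \<and>
        z [^]\<^bsub>G\<^esub> p \<otimes>\<^bsub>G\<^esub> cls [l] = z [^]\<^bsub>G\<^esub> q \<otimes>\<^bsub>G\<^esub> cls w)"
    using letter_image[of l] by blast
  have n0: "0 < n" using n by simp
  obtain p' q' w where ge: "s ^ p' \<cdot>\<^sub>m g (\<sigma> 0) = s ^ q' \<cdot>\<^sub>m word_mat2 lam mu w"
    and zl: "z [^]\<^bsub>G\<^esub> p' \<otimes>\<^bsub>G\<^esub> cls [l] = z [^]\<^bsub>G\<^esub> q' \<otimes>\<^bsub>G\<^esub> cls w"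
    using * \<sigma>[OF n0] by blast
  have g: "\<And>i. i < n \<Longrightarrow> g i \<in> carrier_mat 2 2" using * by blast
  have "\<rho> (cls (u @ [l])) = block_monomial n \<sigma> f * block_monomial n \<tau> g"
    by (simp add: cls_append cls_carrier u l)
  also have "\<dots> = block_monomial n (\<lambda>i. \<tau> (\<sigma> i)) (\<lambda>i. f i * g (\<sigma> i))"
    by (rule block_monomial_mult[OF \<sigma> f g])
  finally have ul: "\<rho> (cls (u @ [l])) = block_monomial n (\<lambda>i. \<tau> (\<sigma> i)) (\<lambda>i. f i * g (\<sigma> i))" .
  have bounds: "\<forall>i<n. \<tau> (\<sigma> i) < n \<and> f i * g (\<sigma> i) \<in> carrier_mat 2 2"
    using * \<sigma> f g by (meson mult_carrier_mat)
  have "s ^ (p + p') \<cdot>\<^sub>m (f 0 * g (\<sigma> 0)) = (s ^ p \<cdot>\<^sub>m f 0) * (s ^ p' \<cdot>\<^sub>m g (\<sigma> 0))"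
    by (simp add: smult_mult_smult_mat[OF f[OF n0] g[OF \<sigma>[OF n0]]] power_add)
  also have "\<dots> = s ^ (q + q') \<cdot>\<^sub>m word_mat2 lam mu (v @ w)"
    unfolding f0 ge
    by (simp add: smult_mult_smult_mat[OF word_mat2_carrier word_mat2_carrier] power_add word_mat2_append)
  finally have mat: "s ^ (p + p') \<cdot>\<^sub>m (f 0 * g (\<sigma> 0)) = s ^ (q + q') \<cdot>\<^sub>m word_mat2 lam mu (v @ w)" .
  \<comment> \<open>The power \<open>b\<close> of \<open>z\<close> is moved past
    \<open>cls u'\<close>, so the equations for \<open>u\<close> and for \<open>l\<close> can be
    multiplied.\<close>
  have split: "z [^]\<^bsub>G\<^esub> (a + b) \<otimes>\<^bsub>G\<^esub> cls (u' @ v') =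
      (z [^]\<^bsub>G\<^esub> a \<otimes>\<^bsub>G\<^esub> cls u') \<otimes>\<^bsub>G\<^esub> (z [^]\<^bsub>G\<^esub> b \<otimes>\<^bsub>G\<^esub> cls v')" for a b :: nat and u' v'
  proof -
    have "z [^]\<^bsub>G\<^esub> (a + b) \<otimes>\<^bsub>G\<^esub> cls (u' @ v') =
        z [^]\<^bsub>G\<^esub> a \<otimes>\<^bsub>G\<^esub> ((z [^]\<^bsub>G\<^esub> b \<otimes>\<^bsub>G\<^esub> cls u') \<otimes>\<^bsub>G\<^esub> cls v')"
      by (simp add: cls_append cls_carrier G.m_assoc flip: G.nat_pow_mult)
    then show ?thesis
      unfolding z_pow_central[of b u'] by (simp add: cls_carrier G.m_assoc)
  qed
  have "z [^]\<^bsub>G\<^esub> (p + p') \<otimes>\<^bsub>G\<^esub> cls (u @ [l]) = z [^]\<^bsub>G\<^esub> (q + q') \<otimes>\<^bsub>G\<^esub> cls (v @ w)"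
    unfolding split zu zl ..
  with ul bounds mat show ?case by blast
qed

lemma rho_injective:
  assumes "norm lam \<ge> 2" "norm mu \<ge> 2" and root: "\<And>k::nat. k > 0 \<Longrightarrow> s ^ k \<noteq> 1"
  shows "inj_on \<rho> (carrier G)"
proof -
  interpret group_hom G "GL (2 * n) K" \<rho> by (rule group_hom_rho)
  \<comment> \<open>Two equal powers of \<open>s\<close> with different exponents would make
    \<open>s\<close> a root of unity.\<close>
  have pow_inj: "i = j" if "s ^ i = s ^ j" for i j :: nat
  proof -
    have "i = j" if "s ^ i = s ^ j" "i \<le> j" for i j :: nat
    proof (rule ccontr)
      assume "i \<noteq> j"
      have "s ^ j = s ^ i * s ^ (j - i)"
        using that(2) by (simp flip: power_add)
      then have "s ^ (j - i) = 1" using s that(1) by simp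
      then show False using root[of "j - i"] \<open>i \<noteq> j\<close> that(2) by simp
    qed
    from this[of i j] this[of j i] that show ?thesis by (metis nat_le_linear)
  qed
  have "kernel G (GL (2 * n) K) \<rho> \<subseteq> {\<one>\<^bsub>G\<^esub>}"
  proof
    fix C assume C: "C \<in> kernel G (GL (2 * n) K) \<rho>"
    then obtain u where u: "C = cls u"
      by (auto simp: kernel_def artin_group_def presented_group_def)
    obtain \<sigma> f p q v where \<rho>u: "\<rho> (cls u) = block_monomial n \<sigma> f"
      and \<sigma>f: "\<forall>i<n. \<sigma> i < n \<and> f i \<in> carrier_mat 2 2"
      and f0: "s ^ p \<cdot>\<^sub>m f 0 = s ^ q \<cdot>\<^sub>m word_mat2 lam mu v"
      and zu: "z [^]\<^bsub>G\<^esub> p \<otimes>\<^bsub>G\<^esub> cls u = z [^]\<^bsub>G\<^esub> q \<otimes>\<^bsub>G\<^esub> cls v"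
      using word_image[of u] by blast
    have "block_monomial n \<sigma> f = 1\<^sub>m (2 * n)"
      using C by (simp add: kernel_def u \<rho>u)
    then have "f 0 = 1\<^sub>m 2"
      using block_monomial_eq_oneD(2)[of n \<sigma> f] \<sigma>f n by simp
    moreover obtain a b c d where v: "word_mat2 lam mu v = mat2 a b c d" and det: "a * d - b * c = 1"
      using word_mat2_det_one by blast
    ultimately have eqs: "s ^ p = s ^ q * a" "s ^ q * b = 0" "s ^ q * c = 0" "s ^ p = s ^ q * d"
      using f0 by (auto simp: one_mat_2 smult_mat2)
    then have bc: "b = 0" "c = 0" using s by auto
    \<comment> \<open>Determinants of both sides of \<open>f0\<close>: the identity scaled by
      \<open>s ^ p\<close> against a matrix of determinant 1 scaled by \<open>s ^ q\<close>.\<close>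
    have "s ^ (2 * p) = s ^ p * s ^ p" by (simp add: power_add mult_2)
    also have "\<dots> = (s ^ q * s ^ q) * (a * d)"
      by (subst (2) eqs(4), subst eqs(1)) simp
    also have "\<dots> = s ^ (2 * q)" using det bc by (simp add: power_add mult_2)
    finally have "p = q" using pow_inj by fastforce
    then have "word_mat2 lam mu v = 1\<^sub>m 2"
      using eqs bc s by (auto simp: v one_mat_2)
    then have "cls v = \<one>\<^bsub>G\<^esub>"
      using pres_eq_Nil_if_word_mat2_eq_one[OF assms(1,2)]
      by (simp add: pres_class_eq_iff flip: cls_Nil)
    \<comment> \<open>With \<open>p = q\<close> and \<open>cls v\<close> trivial, the power of
      \<open>z\<close> cancels in \<open>zu\<close>.\<close>
    then show "C \<in> {\<one>\<^bsub>G\<^esub>}"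
      using zu \<open>p = q\<close> by (simp add: u cls_carrier)
  qed
  then show ?thesis
    using inj_iff_trivial_ker by (auto simp: kernel_def)
qed

end

end

theorem proposition2:
  fixes n :: nat and lam mu s :: complex
  assumes "n \<ge> 2" and "s \<noteq> 0"
  shows "(\<exists>\<rho> \<in> hom (artin_group n) (GL (2 * n) (laurent_ring lam mu s)).
            \<rho> (artin_x n) = x_mat n lam \<and> \<rho> (artin_y n) = y_mat n lam mu s)
       \<and> (norm lam \<ge> 2 \<and> norm mu \<ge> 2 \<and> (\<forall>k::nat. k > 0 \<longrightarrow> s ^ k \<noteq> 1) \<longrightarrow>
            (\<forall>\<rho> \<in> hom (artin_group n) (GL (2 * n) (laurent_ring lam mu s)).
               \<rho> (artin_x n) = x_mat n lam \<and> \<rho> (artin_y n) = y_mat n lam mu s \<longrightarrow>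
               inj_on \<rho> (carrier (artin_group n))))"
  using ex_representation[OF assms] rho_injective[OF assms] by blast

end
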